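(* The complex structure $I_2$ on the hyperkähler manifold $\mathcal{O}_x^{\mathbb{C}}\simeq T^*\mathbb{CP}^1$ (described in the context), which extends the complex structure of $\mathbb{CP}^1$, restricts to a complex structure on $\mathbb{H}^2\simeq\mathcal{O}_x^{n.c.}=\pi^{-1}(x)\subset\mathcal{O}_x^{\mathbb{C}}$, and this complex structure differs from the natural complex structure of $\mathbb{H}^2=\{z\in\mathbb{C}:|z|<1\}$ induced by its embedding into $\mathbb{C}$.
   Context: $x:=\begin{pmatrix}i&0\\0&-i\end{pmatrix}$. $\mathcal{O}_x$, $\mathcal{O}_x^{\mathbb{C}}$, $\mathcal{O}_x^{n.c.}$ denote the orbits of $x$ under the adjoint actions (conjugation, $\mathrm{Ad}(g)(y)=gyg^{-1}$) of $SU(2)$, $SL(2,\mathbb{C})$ and $SU(1,1):=\left\{\begin{pmatrix}a&b\\ \bar b&\bar a\end{pmatrix}:|a|^2-|b|^2=1\right\}$ respectively; $\mathcal{O}_x\simeq\mathbb{CP}^1$ by sending an element to its eigenline for the eigenvalue $i$. Let $\mathfrak{t}=\left\{\begin{pmatrix}i\theta&0\\0&-i\theta\end{pmatrix}:\theta\in\mathbb{R}\right\}$, $\mathfrak{m}=\left\{\begin{pmatrix}0&-\bar c\\c&0\end{pmatrix}:c\in\mathbb{C}\right\}$, so $\mathfrak{su}(2)=\mathfrak{t}\oplus\mathfrak{m}$. By Mostow's decomposition every element of $SL(2,\mathbb{C})$ is uniquely $k\cdot f\cdot e$ with $k\in SU(2)$, $f\in\exp i\mathfrak{m}$, $e\in\exp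 i\mathfrak{t}$, and the $SU(2)$-equivariant fibration $\pi:\mathcal{O}_x^{\mathbb{C}}\to\mathcal{O}_x$ is $\pi(\mathrm{Ad}(kfe)(x))=\mathrm{Ad}(k)(x)$. Its fiber over $x$ is $\pi^{-1}(x)=\mathrm{Ad}(\exp i\mathfrak{m})(x)=\mathcal{O}_x^{n.c.}$, and $\mathcal{O}_x^{\mathbb{C}}$ is $SU(2)$-equivariantly diffeomorphic to $T\mathbb{CP}^1\simeq T^*\mathbb{CP}^1$. The identification $\mathcal{O}_x^{n.c.}\simeq SU(1,1)/U(1)\simeq\mathbb{H}^2$, where $U(1)=\exp\mathfrak{t}$, is the diffeomorphism $\mathrm{Ad}\begin{pmatrix}a&b\\ \bar b&\bar a\end{pmatrix}(x)\mapsto b/\bar a$; the complex structure on $\mathcal{O}_x^{n.c.}$ is transported to $\mathbb{H}^2$ by this diffeomorphism and compared there with multiplication by $i$ on $T_Z\mathbb{H}^2=\mathbb{C}$. For $\mathfrak{c}\in\mathfrak{sl}(2,\mathbb{C})$, $X^{\mathfrak{c}}$ is the vector field on $\mathcal{O}_x^{\mathbb{C}}$ given by $X^{\mathfrak{c}}(y)=[\mathfrak{c},y]$, and $\mathrm{ad}_x=[x,\cdot]$. One has $\mathrm{ad}_x^2=-\alpha^2$ on $\mathfrak{m}$ with $\alpha=2$, and the complex structure of $\mathcal{O}_x\simeq\mathbb{CP}^1$ at $x$ is $X^{\mathfrak{c}}\mapsto X^{\frac12\mathrm{ad}_x\mathfrak{c}}$, $\mathfrak{c}\in\mathfrak{m}$.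 The orbit $\mathcal{O}_x^{\mathbb{C}}$ carries an $SU(2)$-invariant hyperkähler structure (Biquard–Gauduchon), compatible with the Kirillov–Kostant–Souriau complex symplectic form and extending the Kähler structure of $\mathcal{O}_x$. Its complex structure $I_1$ is multiplication by $i$, and its complex structure $I_2$ is the $SU(2)$-invariant one given at $y\in\pi^{-1}(x)$, for $\mathfrak{d}\in\mathfrak{m}$, by $$I_2X^{\mathfrak{d}}(y)=X^{\frac12\mathrm{ad}_x\mathfrak{d}}(y),\qquad I_2X^{i\mathfrak{d}}(y)=-X^{\frac12\mathrm{ad}_x(i\mathfrak{d})}(y).$$ *)

theory Defs
  imports "HOL-Analysis.Analysis"
begin

text \<open>\<open>Ck_on k f S\<close> is meant for open \<open>S\<close>. Derivatives are taken direction by direction, so that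
  all the iterated derivatives keep the type of \<open>f\<close>; in finite dimension this is the usual
  notion of a \<open>k\<close> times continuously differentiable map.\<close>

primrec Ck_on ::
  "nat \<Rightarrow> ('a::euclidean_space \<Rightarrow> 'b::euclidean_space) \<Rightarrow> 'a set \<Rightarrow> bool" where
  "Ck_on 0 f S \<longleftrightarrow> continuous_on S f"
| "Ck_on (Suc k) f S \<longleftrightarrow>
     (\<exists>f'. (\<forall>x\<in>S. (f has_derivative f' x) (at x)) \<and> (\<forall>v. Ck_on k (\<lambda>x. f' x v) S))"

definition smooth_on :: "('a::euclidean_space \<Rightarrow> 'b::euclidean_space) \<Rightarrow> 'a set \<Rightarrow> bool" where
  "smooth_on f S \<longleftrightarrow> (\<forall>k. Ck_on k f S)"

abbreviation differential ::
  "('a::euclidean_space \<Rightarrow> 'b::euclidean_space) \<Rightarrow> 'a \<Rightarrow> 'a \<Rightarrow> 'b" where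
  "differential f x \<equiv> frechet_derivative f (at x)"

text \<open>Velocities of curves contained in \<open>S\<close>. For an embedded submanifold \<open>S\<close> this is the
  tangent space; tangent vectors are elements of the ambient space.\<close>

definition tangent_space :: "'a::euclidean_space set \<Rightarrow> 'a \<Rightarrow> 'a set" where
  "tangent_space S y =
     {v. \<exists>\<gamma> \<epsilon>. \<epsilon> > 0 \<and> (\<forall>t::real. \<bar>t\<bar> < \<epsilon> \<longrightarrow> \<gamma> t \<in> S) \<and> \<gamma> 0 = y \<and>
            (\<gamma> has_vector_derivative v) (at 0)}"

definition surface_param ::
  "complex set \<Rightarrow> (complex \<Rightarrow> 'a::euclidean_space) \<Rightarrow> 'a set \<Rightarrow> bool" where
  "surface_param V \<psi> S \<longleftrightarrow>
     open V \<and> smooth_on \<psi> V \<and> (\<forall>z\<in>V. inj (differential \<psi> z)) \<and>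
     \<psi> ` V \<subseteq> S \<and> openin (top_of_set S) (\<psi> ` V) \<and> (\<exists>\<phi>. homeomorphism V (\<psi> ` V) \<psi> \<phi>)"

text \<open>\<open>J y\<close> is an endomorphism of the tangent space at \<open>y\<close>; its values elsewhere are irrelevant.
  A complex structure on a surface is an almost complex structure that comes from an atlas of
  holomorphic charts, that is, \<open>S\<close> is covered by parametrisations which intertwine \<open>J\<close> with
  multiplication by \<open>\<i>\<close>.\<close>

definition almost_complex_on :: "'a::euclidean_space set \<Rightarrow> ('a \<Rightarrow> 'a \<Rightarrow> 'a) \<Rightarrow> bool" where
  "almost_complex_on S J \<longleftrightarrow>
     (\<forall>y\<in>S. \<forall>v\<in>tangent_space S y. J y v \<in> tangent_space S y \<and> J y (J y v) = - v) \<and>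
     (\<forall>y\<in>S. \<forall>u\<in>tangent_space S y. \<forall>v\<in>tangent_space S y. \<forall>a b.
        J y (a *\<^sub>R u + b *\<^sub>R v) = a *\<^sub>R J y u + b *\<^sub>R J y v)"

definition complex_structure_on :: "'a::euclidean_space set \<Rightarrow> ('a \<Rightarrow> 'a \<Rightarrow> 'a) \<Rightarrow> bool" where
  "complex_structure_on S J \<longleftrightarrow>
     almost_complex_on S J \<and>
     (\<forall>y\<in>S. \<exists>V \<psi>. y \<in> \<psi> ` V \<and> surface_param V \<psi> S \<and>
        (\<forall>z\<in>V. \<forall>w. J (\<psi> z) (differential \<psi> z w) = differential \<psi> z (\<i> * w)))"

text \<open>The field of endomorphisms on the source of \<open>\<psi>\<close> that the differential of \<open>\<psi>\<close> intertwines
  with \<open>J\<close>.\<close>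

definition transported ::
  "('a::euclidean_space \<Rightarrow> 'b::euclidean_space) \<Rightarrow> ('b \<Rightarrow> 'b \<Rightarrow> 'b) \<Rightarrow> 'a \<Rightarrow> 'a \<Rightarrow> 'a" where
  "transported \<psi> J Z v = (THE w. differential \<psi> Z w = J (\<psi> Z) (differential \<psi> Z v))"

type_synonym cmat = "complex^2^2"

definition mat2 :: "complex \<Rightarrow> complex \<Rightarrow> complex \<Rightarrow> complex \<Rightarrow> cmat" where
  "mat2 a b c d = vector [vector [a, b], vector [c, d]]"

definition cscale :: "complex \<Rightarrow> cmat \<Rightarrow> cmat" where
  "cscale c A = map_matrix ((*) c) A"

text \<open>The library multiplication \<open>*\<close>, and hence its power and \<open>exp\<close>, would be entrywise.\<close>

definition mexp :: "cmat \<Rightarrow> cmat" where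
  "mexp A = (\<Sum>n. (1 / fact n) *\<^sub>R ((((**) A) ^^ n) (mat 1)))"

definition commut :: "cmat \<Rightarrow> cmat \<Rightarrow> cmat" where
  "commut A B = A ** B - B ** A"

definition Ad :: "cmat \<Rightarrow> cmat \<Rightarrow> cmat" where
  "Ad g y = g ** y ** matrix_inv g"

definition SL2C :: "cmat set" where
  "SL2C = {g. det g = 1}"

definition SU2 :: "cmat set" where
  "SU2 = {g. map_matrix cnj (transpose g) ** g = mat 1 \<and> det g = 1}"

definition SU11 :: "cmat set" where
  "SU11 = {mat2 a b (cnj b) (cnj a) | a b. (cmod a)\<^sup>2 - (cmod b)\<^sup>2 = 1}"

definition t_alg :: "cmat set" where
  "t_alg = {mat2 (\<i> * of_real \<theta>) 0 0 (- (\<i> * of_real \<theta>)) | \<theta>::real. True}"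

definition m_alg :: "cmat set" where
  "m_alg = {mat2 0 (- cnj c) c 0 | c. True}"

definition x_elem :: cmat where
  "x_elem = mat2 \<i> 0 0 (- \<i>)"

definition orbit_SU2 :: "cmat set" where
  "orbit_SU2 = (\<lambda>g. Ad g x_elem) ` SU2"

definition orbit_SL2C :: "cmat set" where
  "orbit_SL2C = (\<lambda>g. Ad g x_elem) ` SL2C"

definition orbit_SU11 :: "cmat set" where
  "orbit_SU11 = (\<lambda>g. Ad g x_elem) ` SU11"

definition mostow_proj :: "cmat \<Rightarrow> cmat" where
  "mostow_proj y = (THE p. \<exists>k\<in>SU2. \<exists>f\<in>mexp ` cscale \<i> ` m_alg. \<exists>e\<in>mexp ` cscale \<i> ` t_alg.
     y = Ad (k ** f ** e) x_elem \<and> p = Ad k x_elem)"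

definition mostow_fibre :: "cmat \<Rightarrow> cmat set" where
  "mostow_fibre p = {y \<in> orbit_SL2C. mostow_proj y = p}"

definition X_field :: "cmat \<Rightarrow> cmat \<Rightarrow> cmat" where
  "X_field c y = commut c y"

definition half_ad_x :: "cmat \<Rightarrow> cmat" where
  "half_ad_x c = (1/2) *\<^sub>R commut x_elem c"

text \<open>The \<open>SU(2)\<close>-invariant complex structure of the compact orbit: since the orbit lies in the
  linear space of matrices, the differential of the action of \<open>k\<close> is \<open>Ad k\<close> itself. In the
  coordinate given by the eigenline for the eigenvalue \<open>\<i>\<close> it is multiplication by \<open>- \<i>\<close>.\<close>

definition J_CP1 :: "cmat \<Rightarrow> cmat \<Rightarrow> cmat" where
  "J_CP1 y v = (THE w. \<exists>k\<in>SU2. \<exists>c\<in>m_alg. y = Ad k x_elem \<and>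
     v = Ad k (X_field c x_elem) \<and> w = Ad k (X_field (half_ad_x c) x_elem))"

text \<open>At a point \<open>y\<close> of the fibre over \<open>x_elem\<close> the real tangent space of the complex orbit is
  spanned by the vectors \<open>X_field d y\<close> and \<open>X_field (cscale \<i> e) y\<close> with \<open>d\<close>, \<open>e\<close> in \<open>m_alg\<close>.
  The structure is prescribed on these vectors, real-linearly, and extended to the whole orbit by
  \<open>SU(2)\<close>-invariance.\<close>

definition I2 :: "cmat \<Rightarrow> cmat \<Rightarrow> cmat" where
  "I2 y v = (THE w. \<exists>k\<in>SU2. \<exists>y'\<in>mostow_fibre x_elem. \<exists>d\<in>m_alg. \<exists>e\<in>m_alg.
     y = Ad k y' \<and>
     v = Ad k (X_field d y' + X_field (cscale \<i> e) y') \<and>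
     w = Ad k (X_field (half_ad_x d) y' - X_field (half_ad_x (cscale \<i> e)) y'))"

definition hdisc :: "complex set" where
  "hdisc = {z. cmod z < 1}"

definition to_disc :: "cmat \<Rightarrow> complex" where
  "to_disc y = (THE Z. \<exists>a b. (cmod a)\<^sup>2 - (cmod b)\<^sup>2 = 1 \<and>
     y = Ad (mat2 a b (cnj b) (cnj a)) x_elem \<and> Z = b / cnj a)"

definition from_disc :: "complex \<Rightarrow> cmat" where
  "from_disc = inv_into orbit_SU11 to_disc"

definition I2_disc :: "complex \<Rightarrow> complex \<Rightarrow> complex" where
  "I2_disc = transported from_disc I2"

definition natural_structure :: "complex \<Rightarrow> complex \<Rightarrow> complex" where
  "natural_structure Z v = \<i> * v"

end

theory Submission
  imports Defs
begin

text \<open>Split a matrix into its skew-Hermitian and Hermitian parts, \<open>y = A + H\<close>. Then \<open>y\<close> lies in the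
  complex orbit iff \<open>A\<close> and \<open>H\<close> are traceless and orthogonal with \<open>det A + det H = 1\<close>, and the
  Mostow projection normalises \<open>A\<close>. Hence the fibre over \<open>x\<close> consists of the matrices
  \<open>sqrt (1 + |w|\<^sup>2) x + H(w)\<close>, one for each complex number \<open>w\<close>, and \<open>w = 2 Z / (1 - |Z|\<^sup>2)\<close> in terms of
  the disc coordinate. The structure \<open>I2\<close> is given by a closed \<open>SU(2)\<close>-equivariant formula, from which
  one reads off that it acts on the fibre by \<open>w \<mapsto> - \<i> w\<close>. So the complex conjugate of \<open>w\<close> is a global
  holomorphic coordinate for \<open>I2\<close>, and at the centre of the disc, where \<open>w\<close> and \<open>2 Z\<close> agree to first
  order, \<open>I2\<close> is multiplication by \<open>- \<i>\<close>.\<close>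

section \<open>Two by two matrices\<close>

text \<open>\<open>mostow_proj\<close>, \<open>to_disc\<close>, \<open>J_CP1\<close> and
  \<open>I2\<close> are definite descriptions over choices that are not unique: k may be multiplied
  by the torus fixing x, and (a, b) by opposite phases. Each is therefore matched with an expression
  in y alone, or in y and v, that makes no choice, and every admissible choice is shown to yield it.
  Since \<open>I2\<close> is determined only on tangent vectors, and these are velocities of curves,
  the tangent space of the complex orbit has to be computed as well; it is the linearisation of y^2
  = -1. The minus sign in - i has its source in the prescription of \<open>I2\<close>, which treats
  m and i m with opposite signs and so is conjugate linear on m + i m. The directions tangent to the
  fibre are the fields of i m, where the sign is negative, and half of ad x multiplies the upper
  right entry, which carries w, by i.\<close>

lemma mat2_nth [simp]:
  "mat2 a b c d $ 1 $ 1 = a" "mat2 a b c d $ 1 $ 2 = b"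
  "mat2 a b c d $ 2 $ 1 = c" "mat2 a b c d $ 2 $ 2 = d"
  by (simp_all add: mat2_def)

lemma cmat_eq_iff:
  "A = B \<longleftrightarrow> A$1$1 = B$1$1 \<and> A$1$2 = B$1$2 \<and> A$2$1 = B$2$1 \<and> A$2$2 = B$2$2"
  for A B :: cmat
  by (auto simp: vec_eq_iff forall_2)

lemma mat2_cases:
  obtains a b c d where "A = mat2 a b c d"
  using that[of "A$1$1" "A$1$2" "A$2$1" "A$2$2"] by (simp add: cmat_eq_iff)

definition adj :: "cmat \<Rightarrow> cmat" where
  "adj A = map_matrix cnj (transpose A)"

lemma mat2_eq_iff: "mat2 a b c d = mat2 a' b' c' d' \<longleftrightarrow> a = a' \<and> b = b' \<and> c = c' \<and> d = d'"
  by (simp add: cmat_eq_iff)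

lemma mat2_zero: "0 = mat2 0 0 0 0" and mat2_one: "mat 1 = mat2 1 0 0 1"
  by (simp_all add: cmat_eq_iff mat_def)

lemma mat2_mult:
  "mat2 a b c d ** mat2 a' b' c' d' =
    mat2 (a * a' + b * c') (a * b' + b * d') (c * a' + d * c') (c * b' + d * d')"
  by (simp add: cmat_eq_iff matrix_matrix_mult_def sum_2)

lemma mat2_add: "mat2 a b c d + mat2 a' b' c' d' = mat2 (a + a') (b + b') (c + c') (d + d')"
  and mat2_diff: "mat2 a b c d - mat2 a' b' c' d' = mat2 (a - a') (b - b') (c - c') (d - d')"
  and mat2_uminus: "- mat2 a b c d = mat2 (- a) (- b) (- c) (- d)"
  and mat2_scaleR: "r *\<^sub>R mat2 a b c d = mat2 (r *\<^sub>R a) (r *\<^sub>R b) (r *\<^sub>R c) (r *\<^sub>R d)"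
  and mat2_cscale: "cscale z (mat2 a b c d) = mat2 (z * a) (z * b) (z * c) (z * d)"
  and mat2_adj: "adj (mat2 a b c d) = mat2 (cnj a) (cnj c) (cnj b) (cnj d)"
  by (simp_all add: cmat_eq_iff cscale_def adj_def transpose_def map_matrix_def)

lemma mat2_det: "det (mat2 a b c d) = a * d - b * c"
  by (simp add: det_2)

lemma mat2_trace: "trace (mat2 a b c d) = a + d"
  by (simp add: trace_def sum_2)

lemmas mat2_ring = mat2_mult mat2_add mat2_diff mat2_uminus mat2_scaleR mat2_cscale
  mat2_adj mat2_det mat2_trace commut_def mat2_zero mat2_one

text \<open>\<open>matrix_inv\<close> is a Hilbert choice, so exhibiting an inverse is not enough:
  two-sided inverses must be seen to be unique.\<close>

lemma matrix_inv_mat2: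
  assumes "a * d - b * c = 1"
  shows "matrix_inv (mat2 a b c d) = mat2 d (- b) (- c) a"
proof -
  have 1: "mat2 a b c d ** mat2 d (- b) (- c) a = mat 1" "mat2 d (- b) (- c) a ** mat2 a b c d = mat 1"
    using assms by (simp_all add: mat2_ring mat2_eq_iff algebra_simps)
  have "B = mat2 d (- b) (- c) a" if "mat2 a b c d ** B = mat 1 \<and> B ** mat2 a b c d = mat 1" for B
    by (metis 1 that matrix_mul_assoc matrix_mul_lid matrix_mul_rid)
  then show ?thesis
    unfolding matrix_inv_def using 1 by (metis (mono_tags, lifting) someI_ex)
qed

lemma SL2C_inverse:
  assumes "g \<in> SL2C"
  shows "g ** matrix_inv g = mat 1" "matrix_inv g ** g = mat 1" "matrix_inv g \<in> SL2C"
    "matrix_inv (matrix_inv g) = g"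
proof -
  obtain a b c d where g: "g = mat2 a b c d" by (rule mat2_cases)
  with assms have "a * d - b * c = 1" "d * a - (- b) * (- c) = 1"
    by (simp_all add: SL2C_def mat2_det algebra_simps)
  then show "g ** matrix_inv g = mat 1" "matrix_inv g ** g = mat 1" "matrix_inv g \<in> SL2C"
    "matrix_inv (matrix_inv g) = g"
    unfolding g by (simp_all add: matrix_inv_mat2 mat2_ring mat2_eq_iff SL2C_def algebra_simps)
qed

lemma SL2C_mult: "g \<in> SL2C \<Longrightarrow> h \<in> SL2C \<Longrightarrow> g ** h \<in> SL2C"
  by (simp add: SL2C_def det_mul)

lemma SL2C_inverse_unique:
  assumes "g \<in> SL2C" "h ** g = mat 1"
  shows "matrix_inv g = h"
proof -
  have "h = h ** (g ** matrix_inv g)"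
    by (simp add: SL2C_inverse(1)[OF assms(1)])
  then show ?thesis
    by (simp add: matrix_mul_assoc assms(2))
qed

section \<open>The adjoint action\<close>

lemma Ad_mult:
  assumes "g \<in> SL2C" "h \<in> SL2C"
  shows "Ad (g ** h) A = Ad g (Ad h A)"
proof -
  have "(matrix_inv h ** matrix_inv g) ** (g ** h) = matrix_inv h ** (matrix_inv g ** g) ** h"
    by (simp only: matrix_mul_assoc)
  then have "matrix_inv (g ** h) = matrix_inv h ** matrix_inv g"
    using assms by (intro SL2C_inverse_unique) (simp_all add: SL2C_mult SL2C_inverse)
  then show ?thesis by (simp add: Ad_def matrix_mul_assoc)
qed

lemma Ad_mat_1 [simp]: "Ad (mat 1) A = A"
  using SL2C_inverse(1)[of "mat 1"] by (simp add: Ad_def SL2C_def)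

lemma Ad_inverse:
  assumes "g \<in> SL2C"
  shows "Ad g (Ad (matrix_inv g) A) = A" "Ad (matrix_inv g) (Ad g A) = A"
  using assms by (simp_all add: SL2C_inverse Ad_mult[symmetric])

lemma Ad_matrix_mult:
  assumes "g \<in> SL2C"
  shows "Ad g (A ** B) = Ad g A ** Ad g B"
proof -
  have "Ad g A ** Ad g B = g ** A ** (matrix_inv g ** g) ** B ** matrix_inv g"
    unfolding Ad_def by (simp only: matrix_mul_assoc)
  then show ?thesis
    by (simp add: SL2C_inverse(2)[OF assms] Ad_def matrix_mul_assoc)
qed

lemma Ad_add: "Ad g (A + B) = Ad g A + Ad g B"
  and Ad_diff: "Ad g (A - B) = Ad g A - Ad g B"
  and Ad_uminus: "Ad g (- A) = - Ad g A"
  and Ad_scaleR: "Ad g (r *\<^sub>R A) = r *\<^sub>R Ad g A"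
  and Ad_cscale: "Ad g (cscale z A) = cscale z (Ad g A)"
proof -
  obtain a b c d where g: "g = mat2 a b c d" by (rule mat2_cases)
  \<comment> \<open>The entries of the inverse stay free variables: \<open>Ad g\<close> is linear as
    multiplication by two fixed matrices.\<close>
  obtain a' b' c' d' where gi: "matrix_inv g = mat2 a' b' c' d'" by (rule mat2_cases)
  obtain p q r' s where A: "A = mat2 p q r' s" by (rule mat2_cases)
  obtain p' q' r'' s' where B: "B = mat2 p' q' r'' s'" by (rule mat2_cases)
  show "Ad g (A + B) = Ad g A + Ad g B" "Ad g (A - B) = Ad g A - Ad g B" "Ad g (- A) = - Ad g A"
    "Ad g (r *\<^sub>R A) = r *\<^sub>R Ad g A" "Ad g (cscale z A) = cscale z (Ad g A)"
    unfolding Ad_def gi unfolding g A B by (simp_all add: mat2_ring mat2_eq_iff algebra_simps)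
qed

lemma Ad_commut: "g \<in> SL2C \<Longrightarrow> Ad g (commut A B) = commut (Ad g A) (Ad g B)"
  by (simp add: commut_def Ad_diff Ad_matrix_mult)

lemma det_Ad: "g \<in> SL2C \<Longrightarrow> det (Ad g A) = det A"
  using SL2C_inverse(3)[of g] by (simp add: Ad_def det_mul SL2C_def)

lemma trace_Ad:
  assumes "g \<in> SL2C"
  shows "trace (Ad g A) = trace A"
proof -
  have "trace (Ad g A) = trace (matrix_inv g ** (g ** A))"
    unfolding Ad_def by (rule trace_mul_sym)
  also have "\<dots> = trace A"
    by (simp add: matrix_mul_assoc SL2C_inverse(2)[OF assms])
  finally show ?thesis .
qed

section \<open>Unitary matrices and the conjugate transpose\<close>

lemma SU2_SL2C: "k \<in> SU2 \<Longrightarrow> k \<in> SL2C"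
  by (simp add: SU2_def SL2C_def)

lemma matrix_inv_SU2:
  assumes "k \<in> SU2"
  shows "matrix_inv k = adj k"
proof -
  have "adj k ** k = mat 1" using assms by (simp add: SU2_def adj_def)
  then show ?thesis
    by (rule SL2C_inverse_unique[OF SU2_SL2C[OF assms]])
qed

lemma adj_mult: "adj (A ** B) = adj B ** adj A"
  and adj_adj [simp]: "adj (adj A) = A"
  and adj_add: "adj (A + B) = adj A + adj B"
  and adj_scaleR: "adj (r *\<^sub>R A) = r *\<^sub>R adj A"
proof -
  obtain p q r' s where A: "A = mat2 p q r' s" by (rule mat2_cases)
  obtain p' q' r'' s' where B: "B = mat2 p' q' r'' s'" by (rule mat2_cases)
  show "adj (A ** B) = adj B ** adj A" "adj (adj A) = A" "adj (A + B) = adj A + adj B"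
    "adj (r *\<^sub>R A) = r *\<^sub>R adj A"
    unfolding A B by (simp_all add: mat2_ring mat2_eq_iff algebra_simps)
qed

text \<open>Unitarity enters here: as the inverse of k is its conjugate transpose, conjugation by k
  respects the splitting into skew-Hermitian and Hermitian parts.\<close>

lemma Ad_adj: "k \<in> SU2 \<Longrightarrow> Ad k (adj A) = adj (Ad k A)"
  by (simp add: Ad_def matrix_inv_SU2 adj_mult matrix_mul_assoc)

lemma mat2_in_SU2: "a * cnj a + b * cnj b = 1 \<Longrightarrow> mat2 a b (- cnj b) (cnj a) \<in> SU2"
  unfolding SU2_def adj_def[symmetric] by (simp add: mat2_ring mat2_eq_iff algebra_simps)

section \<open>Smooth maps and parametrised surfaces\<close>

lemma Ck_on_imp_continuous: "Ck_on k f S \<Longrightarrow> continuous_on S f"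
proof (cases k)
  case (Suc j)
  moreover assume "Ck_on k f S"
  ultimately obtain f' where "\<And>x. x \<in> S \<Longrightarrow> (f has_derivative f' x) (at x)"
    by auto
  then have "isCont f x" if "x \<in> S" for x
    using that by (blast intro: has_derivative_continuous)
  then show ?thesis by (simp add: continuous_at_imp_continuous_on)
qed simp

text \<open>A product rule leaves one factor undifferentiated. That factor has order k + 1, while
  the induction hypothesis asks for order k.\<close>

lemma Ck_on_SucD: "Ck_on (Suc k) f S \<Longrightarrow> Ck_on k f S"
proof (induction k arbitrary: f)
  case 0
  then show ?case using Ck_on_imp_continuous[OF 0] by simp
next
  case (Suc k)
  then obtain f' where "\<forall>x\<in>S. (f has_derivative f' x) (at x)" "\<And>v. Ck_on (Suc k) (\<lambda>x. f' x v) S"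
    by auto
  then show ?case
    using Suc.IH unfolding Ck_on.simps(2)[of k f] by blast
qed

lemma Ck_on_cong:
  assumes "Ck_on k f S" "open S" "\<And>x. x \<in> S \<Longrightarrow> f x = g x"
  shows "Ck_on k g S"
proof (cases k)
  case 0
  then show ?thesis using assms continuous_on_cong by fastforce
next
  case (Suc j)
  then obtain f' where "\<And>x. x \<in> S \<Longrightarrow> (f has_derivative f' x) (at x)" "\<And>v. Ck_on j (\<lambda>x. f' x v) S"
    using assms by auto
  then show ?thesis
    unfolding Suc Ck_on.simps using assms(2,3) has_derivative_transform_within_open by blast
qed

lemma Ck_on_const: "Ck_on k (\<lambda>x. c) S"
proof (induction k arbitrary: c)
  case (Suc k)
  then show ?case by (auto intro!: exI[of _ "\<lambda>x v. 0"])
qed auto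

lemma Ck_on_linear:
  assumes "bounded_linear L" "Ck_on k f S"
  shows "Ck_on k (\<lambda>x. L (f x)) S"
  using assms(2)
proof (induction k arbitrary: f)
  case 0
  then show ?case using bounded_linear.continuous_on[OF assms(1)] by auto
next
  case (Suc k)
  then obtain f' where "\<And>x. x \<in> S \<Longrightarrow> (f has_derivative f' x) (at x)" "\<And>v. Ck_on k (\<lambda>x. f' x v) S"
    by auto
  then show ?case
    unfolding Ck_on.simps using bounded_linear.has_derivative[OF assms(1)] Suc.IH
    by (intro exI[of _ "\<lambda>x v. L (f' x v)"]) blast
qed

lemma Ck_on_id: "Ck_on k (\<lambda>x. x) S"
proof (cases k)
  case (Suc j)
  then show ?thesis by (auto intro!: exI[of _ "\<lambda>x v. v"] Ck_on_const)
qed auto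

lemma Ck_on_add:
  assumes "Ck_on k f S" "Ck_on k g S"
  shows "Ck_on k (\<lambda>x. f x + g x) S"
  using assms
proof (induction k arbitrary: f g)
  case 0
  then show ?case by (auto intro: continuous_intros)
next
  case (Suc k)
  obtain f' where "\<And>x. x \<in> S \<Longrightarrow> (f has_derivative f' x) (at x)" "\<And>v. Ck_on k (\<lambda>x. f' x v) S"
    using Suc.prems(1) by auto
  moreover obtain g' where "\<And>x. x \<in> S \<Longrightarrow> (g has_derivative g' x) (at x)" "\<And>v. Ck_on k (\<lambda>x. g' x v) S"
    using Suc.prems(2) by auto
  ultimately show ?case
    using Suc.IH
    by (auto intro!: exI[of _ "\<lambda>x v. f' x v + g' x v"] has_derivative_add)
qed

lemma Ck_on_bilinear:
  assumes "bounded_bilinear p" "Ck_on k f S" "Ck_on k g S"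
  shows "Ck_on k (\<lambda>x. p (f x) (g x)) S"
  using assms(2,3)
proof (induction k arbitrary: f g)
  case 0
  then show ?case using bounded_bilinear.continuous_on[OF assms(1)] by auto
next
  case (Suc k)
  obtain f' where f': "\<And>x. x \<in> S \<Longrightarrow> (f has_derivative f' x) (at x)" "\<And>v. Ck_on k (\<lambda>x. f' x v) S"
    using Suc.prems(1) by auto
  obtain g' where g': "\<And>x. x \<in> S \<Longrightarrow> (g has_derivative g' x) (at x)" "\<And>v. Ck_on k (\<lambda>x. g' x v) S"
    using Suc.prems(2) by auto
  have "Ck_on k (\<lambda>x. p (f x) (g' x v) + p (f' x v) (g x)) S" for v
    by (intro Ck_on_add Suc.IH f' g' Ck_on_SucD[OF Suc.prems(1)] Ck_on_SucD[OF Suc.prems(2)])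
  moreover have "((\<lambda>x. p (f x) (g x)) has_derivative (\<lambda>v. p (f x) (g' x v) + p (f' x v) (g x))) (at x)"
    if "x \<in> S" for x
    using bounded_bilinear.FDERIV[OF assms(1) f'(1)[OF that] g'(1)[OF that]] .
  ultimately show ?case
    by (auto intro!: exI[of _ "\<lambda>x v. p (f x) (g' x v) + p (f' x v) (g x)"])
qed

lemmas Ck_on_mult = Ck_on_bilinear[OF bounded_bilinear_mult]
  and Ck_on_scaleR = Ck_on_bilinear[OF bounded_bilinear_scaleR]
  and Ck_on_inner = Ck_on_bilinear[OF bounded_bilinear_inner]

text \<open>The derivative of 1/f is again built from 1/f and f', so the induction runs over the
  order with f fixed. The factor -1 is written as a constant so that the product rule covers the
  whole expression.\<close>

lemma Ck_on_inverse:
  fixes f :: "'a::euclidean_space \<Rightarrow> real"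
  assumes "Ck_on k f S" "\<And>x. x \<in> S \<Longrightarrow> f x \<noteq> 0"
  shows "Ck_on k (\<lambda>x. inverse (f x)) S"
  using assms(1)
proof (induction k)
  case 0
  then show ?case using assms(2) by (auto intro: continuous_on_inverse)
next
  case (Suc k)
  obtain f' where f': "\<And>x. x \<in> S \<Longrightarrow> (f has_derivative f' x) (at x)" "\<And>v. Ck_on k (\<lambda>x. f' x v) S"
    using Suc.prems by auto
  have "Ck_on k (\<lambda>x. (-1) * (inverse (f x) * f' x v * inverse (f x))) S" for v
    by (intro Ck_on_mult Ck_on_const f' Suc.IH Ck_on_SucD[OF Suc.prems])
  moreover have "((\<lambda>x. inverse (f x)) has_derivative
      (\<lambda>v. (-1) * (inverse (f x) * f' x v * inverse (f x)))) (at x)" if "x \<in> S" for x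
    using Deriv.has_derivative_inverse[OF assms(2)[OF that] f'(1)[OF that]] by simp
  ultimately show ?case
    unfolding Ck_on.simps by (intro exI[of _ "\<lambda>x v. (-1) * (inverse (f x) * f' x v * inverse (f x))"]) simp
qed

text \<open>The same bootstrapping as for the inverse: the derivative f' / (2 sqrt f) involves sqrt
  f itself, at one order less.\<close>

lemma Ck_on_sqrt:
  fixes f :: "'a::euclidean_space \<Rightarrow> real"
  assumes "Ck_on k f S" "\<And>x. x \<in> S \<Longrightarrow> f x > 0"
  shows "Ck_on k (\<lambda>x. sqrt (f x)) S"
  using assms(1)
proof (induction k)
  case 0
  then show ?case by (auto intro: continuous_on_real_sqrt)
next
  case (Suc k)
  obtain f' where f': "\<And>x. x \<in> S \<Longrightarrow> (f has_derivative f' x) (at x)" "\<And>v. Ck_on k (\<lambda>x. f' x v) S"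
    using Suc.prems by auto
  have "Ck_on k (\<lambda>x. f' x v * (inverse (sqrt (f x)) * (1 / 2))) S" for v
    using assms(2) by (intro Ck_on_mult Ck_on_const f' Ck_on_inverse Suc.IH Ck_on_SucD[OF Suc.prems]) force
  moreover have "((\<lambda>x. sqrt (f x)) has_derivative
      (\<lambda>v. f' x v * (inverse (sqrt (f x)) * (1 / 2)))) (at x)" if "x \<in> S" for x
    using has_derivative_real_sqrt[OF assms(2)[OF that] f'(1)[OF that]] by (simp add: field_simps)
  ultimately show ?case
    unfolding Ck_on.simps by (intro exI[of _ "\<lambda>x v. f' x v * (inverse (sqrt (f x)) * (1 / 2))"]) simp
qed

lemma smooth_on_imp_differentiable:
  assumes "smooth_on f S" "x \<in> S"
  shows "f differentiable (at x)"
proof -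
  have "Ck_on (Suc 0) f S"
    using assms(1) unfolding smooth_on_def by blast
  then show ?thesis
    using assms(2) unfolding Ck_on.simps differentiable_def by blast
qed

lemma has_derivative_differential:
  "f differentiable (at x) \<Longrightarrow> (f has_derivative differential f x) (at x)"
  by (simp add: frechet_derivative_works)

section \<open>Tangent vectors and differentials of parametrisations\<close>

lemma tangent_spaceI:
  assumes "\<epsilon> > 0" "\<And>t::real. \<bar>t\<bar> < \<epsilon> \<Longrightarrow> \<gamma> t \<in> S" "\<gamma> 0 = y" "(\<gamma> has_vector_derivative v) (at 0)"
  shows "v \<in> tangent_space S y"
  unfolding tangent_space_def using assms by blast

lemma tangent_space_mono: "S \<subseteq> T \<Longrightarrow> tangent_space S y \<subseteq> tangent_space T y"
  unfolding tangent_space_def by blast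

lemma differential_left_inverse:
  assumes "open V" "z \<in> V" "\<psi> differentiable (at z)" "\<phi> differentiable (at (\<psi> z))"
    and "\<And>z. z \<in> V \<Longrightarrow> \<phi> (\<psi> z) = z"
  shows "differential \<phi> (\<psi> z) (differential \<psi> z w) = w"
proof -
  have "((\<lambda>x. \<phi> (\<psi> x)) has_derivative (\<lambda>w. differential \<phi> (\<psi> z) (differential \<psi> z w))) (at z)"
    by (rule has_derivative_compose[OF has_derivative_differential[OF assms(3)]
          has_derivative_differential[OF assms(4)]])
  moreover have "((\<lambda>x. \<phi> (\<psi> x)) has_derivative (\<lambda>w. w)) (at z)"
    by (rule has_derivative_transform_within_open[OF has_derivative_ident assms(1,2)]) (simp add: assms(5))
  ultimately have "(\<lambda>w. differential \<phi> (\<psi> z) (differential \<psi> z w)) = (\<lambda>w. w)"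
    by (rule has_derivative_unique)
  then show ?thesis by (rule fun_cong)
qed

text \<open>The differential at w is the velocity of the image of the line z + t w, which stays in V
  for small t.\<close>

lemma range_differential_subset:
  assumes "open V" "z \<in> V" "\<psi> differentiable (at z)" "\<psi> ` V \<subseteq> S"
  shows "range (differential \<psi> z) \<subseteq> tangent_space S (\<psi> z)"
proof (rule image_subsetI)
  fix w :: 'a
  let ?l = "\<lambda>t::real. z + t *\<^sub>R w"
  have "open (?l -` V)"
    by (intro open_vimage assms continuous_intros)
  then obtain \<epsilon> where \<epsilon>: "\<epsilon> > 0" "ball 0 \<epsilon> \<subseteq> ?l -` V"
    by (rule openE[where x = 0]) (simp_all add: assms(2))
  have "(?l has_derivative (\<lambda>t. t *\<^sub>R w)) (at 0)"
    by (auto intro!: derivative_eq_intros)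
  then have "((\<lambda>t. \<psi> (?l t)) has_derivative (\<lambda>t. differential \<psi> z (t *\<^sub>R w))) (at 0)"
    by (rule has_derivative_compose) (simp add: assms(3) has_derivative_differential)
  then have "((\<lambda>t. \<psi> (?l t)) has_vector_derivative differential \<psi> z w) (at 0)"
    by (simp add: has_vector_derivative_def linear_cmul[OF linear_frechet_derivative[OF assms(3)]])
  then show "differential \<psi> z w \<in> tangent_space S (\<psi> z)"
    using \<epsilon> assms(4) by (intro tangent_spaceI[of \<epsilon> "\<lambda>t. \<psi> (?l t)"]) (auto simp: subset_iff)
qed

text \<open>For the nontrivial inclusion, pull a curve in S back by \<phi> and push it forward again
  by \<psi>. This does not change the curve, so the chain rule displays its velocity as a value of
  the differential of \<psi>.\<close>

lemma tangent_space_eq_range_differential: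
  assumes "open V" "smooth_on \<psi> V" "\<psi> ` V = S" "z \<in> V" "\<phi> differentiable (at (\<psi> z))"
    and inv: "\<And>z. z \<in> V \<Longrightarrow> \<phi> (\<psi> z) = z"
  shows "tangent_space S (\<psi> z) = range (differential \<psi> z)"
proof
  note diff = smooth_on_imp_differentiable[OF assms(2)]
  show "range (differential \<psi> z) \<subseteq> tangent_space S (\<psi> z)"
    using assms diff by (intro range_differential_subset) auto
  show "tangent_space S (\<psi> z) \<subseteq> range (differential \<psi> z)"
  proof
    fix v assume "v \<in> tangent_space S (\<psi> z)"
    then obtain \<gamma> \<epsilon> where \<gamma>: "\<epsilon> > 0" "\<And>t::real. \<bar>t\<bar> < \<epsilon> \<Longrightarrow> \<gamma> t \<in> S" "\<gamma> 0 = \<psi> z"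
      "(\<gamma> has_derivative (\<lambda>t. t *\<^sub>R v)) (at 0)"
      unfolding tangent_space_def has_vector_derivative_def by blast
    have "((\<lambda>t. \<phi> (\<gamma> t)) has_derivative (\<lambda>t. differential \<phi> (\<psi> z) (t *\<^sub>R v))) (at 0)"
      using \<gamma>(3) assms(5) by (intro has_derivative_compose[OF \<gamma>(4)]) (simp add: has_derivative_differential)
    then have *: "((\<lambda>t. \<psi> (\<phi> (\<gamma> t))) has_derivative
        (\<lambda>t. differential \<psi> z (differential \<phi> (\<psi> z) (t *\<^sub>R v)))) (at 0)"
      by (rule has_derivative_compose) (simp add: \<gamma>(3) inv assms(4) diff has_derivative_differential)
    have "\<psi> (\<phi> (\<gamma> t)) = \<gamma> t" if "t \<in> ball 0 \<epsilon>" for t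
      using \<gamma>(2)[of t] that inv assms(3) by auto
    then have "(\<gamma> has_derivative (\<lambda>t. differential \<psi> z (differential \<phi> (\<psi> z) (t *\<^sub>R v)))) (at 0)"
      using \<gamma>(1) by (intro has_derivative_transform_within_open[OF * open_ball[of 0 \<epsilon>]]) simp_all
    then have "(\<lambda>t. t *\<^sub>R v) = (\<lambda>t. differential \<psi> z (differential \<phi> (\<psi> z) (t *\<^sub>R v)))"
      by (rule has_derivative_unique[OF \<gamma>(4)])
    then have "v = differential \<psi> z (differential \<phi> (\<psi> z) v)"
      by (metis scaleR_one)
    then show "v \<in> range (differential \<psi> z)" by blast
  qed
qed

text \<open>The left inverse \<phi> does double duty: its differential makes that of \<psi>
  injective, and its restriction to S is the continuous inverse. Relative openness is clear because
  the image is all of S.\<close>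

lemma surface_paramI:
  assumes "open V" "smooth_on \<psi> V" "\<psi> ` V = S" "\<And>y. y \<in> S \<Longrightarrow> \<phi> differentiable (at y)"
    and inv: "\<And>z. z \<in> V \<Longrightarrow> \<phi> (\<psi> z) = z"
  shows "surface_param V \<psi> S"
proof -
  have "inj (differential \<psi> z)" if "z \<in> V" for z
    using differential_left_inverse[OF assms(1) that smooth_on_imp_differentiable[OF assms(2) that] _ inv]
      assms(3,4) that by (metis image_eqI injI)
  moreover have "homeomorphism V S \<psi> \<phi>"
  proof (rule homeomorphismI)
    show "continuous_on V \<psi>"
      using assms(2) Ck_on_imp_continuous unfolding smooth_on_def by blast
    show "continuous_on S \<phi>"
      using assms(4) by (meson continuous_at_imp_continuous_on differentiable_imp_continuous_within)
  qed (use assms(3) inv in auto)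
  ultimately show ?thesis
    using assms unfolding surface_param_def by auto
qed

text \<open>A single global parametrisation suffices, provided it has a left inverse that is
  differentiable in the ambient space.\<close>

lemma complex_structure_onI:
  assumes "open V" "smooth_on \<psi> V" "\<psi> ` V = S" "\<And>y. y \<in> S \<Longrightarrow> \<phi> differentiable (at y)"
    and inv: "\<And>z. z \<in> V \<Longrightarrow> \<phi> (\<psi> z) = z"
    and J: "\<And>z w. z \<in> V \<Longrightarrow> J (\<psi> z) (differential \<psi> z w) = differential \<psi> z (\<i> * w)"
  shows "complex_structure_on S J"
proof -
  note diff = smooth_on_imp_differentiable[OF assms(2)]
  have T: "tangent_space S (\<psi> z) = range (differential \<psi> z)" if "z \<in> V" for z
    using assms that by (intro tangent_space_eq_range_differential[where \<phi> = \<phi>]) auto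
  have lin: "linear (differential \<psi> z)" if "z \<in> V" for z
    using diff[OF that] linear_frechet_derivative by blast
  have "J y v \<in> tangent_space S y \<and> J y (J y v) = - v" if y: "y \<in> S" "v \<in> tangent_space S y" for y v
  proof -
    obtain z w where z: "z \<in> V" "y = \<psi> z" "v = differential \<psi> z w"
      using y T assms(3) by blast
    show ?thesis
      using J[OF z(1)] T[OF z(1)] linear_neg[OF lin[OF z(1)], of w]
      by (simp add: z(2,3) flip: mult.assoc)
  qed
  moreover have "J y (a *\<^sub>R u + b *\<^sub>R v) = a *\<^sub>R J y u + b *\<^sub>R J y v"
    if y: "y \<in> S" "u \<in> tangent_space S y" "v \<in> tangent_space S y" for y u v a b
  proof -
    obtain z where z: "z \<in> V" "y = \<psi> z" using y(1) assms(3) by blast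
    obtain w w' where w: "u = differential \<psi> z w" "v = differential \<psi> z w'"
      using y(2,3) T[OF z(1)] z(2) by blast
    have 1: "a *\<^sub>R u + b *\<^sub>R v = differential \<psi> z (a *\<^sub>R w + b *\<^sub>R w')"
      by (simp add: w linear_add[OF lin[OF z(1)]] linear_cmul[OF lin[OF z(1)]])
    have 2: "\<i> * (a *\<^sub>R w + b *\<^sub>R w') = a *\<^sub>R (\<i> * w) + b *\<^sub>R (\<i> * w')"
      by (simp add: algebra_simps)
    show ?thesis
      unfolding 1 unfolding w z(2) J[OF z(1)] 2
      by (simp only: linear_add[OF lin[OF z(1)]] linear_cmul[OF lin[OF z(1)]])
  qed
  ultimately have "almost_complex_on S J"
    unfolding almost_complex_on_def by simp
  moreover have "\<exists>V \<psi>. y \<in> \<psi> ` V \<and> surface_param V \<psi> S \<and>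
      (\<forall>z\<in>V. \<forall>w. J (\<psi> z) (differential \<psi> z w) = differential \<psi> z (\<i> * w))" if "y \<in> S" for y
    using surface_paramI[OF assms(1-4) inv] J assms(3) that
    by (intro exI[of _ V] exI[of _ \<psi>]) simp
  ultimately show ?thesis
    unfolding complex_structure_on_def by simp
qed

section \<open>The fibre and the disc\<close>

text \<open>The elements of m + i m. Each pair d, e in the prescription of \<open>I2\<close>
  contributes one of them, d + i e.\<close>

definition off_diag :: "complex \<Rightarrow> complex \<Rightarrow> cmat" where
  "off_diag \<beta> \<gamma> = mat2 0 \<beta> \<gamma> 0"

text \<open>The off-diagonal Hermitian matrices, that is i m. The factor - i is chosen to give the
  parameter the simple value w = 2 a b in \<open>Ad_SU11_x\<close>.\<close>

definition fibre_lin :: "complex \<Rightarrow> cmat" where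
  "fibre_lin w = mat2 0 (- (\<i> * w)) (\<i> * cnj w) 0"

definition fibre_pt :: "complex \<Rightarrow> cmat" where
  "fibre_pt w = sqrt (1 + w \<bullet> w) *\<^sub>R x_elem + fibre_lin w"

lemma fibre_pt_mat2:
  "fibre_pt w = mat2 (\<i> * of_real (sqrt (1 + w \<bullet> w))) (- (\<i> * w)) (\<i> * cnj w) (- (\<i> * of_real (sqrt (1 + w \<bullet> w))))"
  by (simp add: fibre_pt_def fibre_lin_def x_elem_def mat2_ring mat2_eq_iff) (simp add: scaleR_conv_of_real)

lemma inner_cnj: "of_real (w \<bullet> w) = w * cnj w" for w :: complex
  by (simp only: complex_norm_square dot_square_norm)

lemma of_real_sqrt_inner:
  "complex_of_real (sqrt (1 + w \<bullet> w)) * of_real (sqrt (1 + w \<bullet> w)) = 1 + w * cnj w" for w :: complex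
proof -
  have "sqrt (1 + w \<bullet> w) * sqrt (1 + w \<bullet> w) = 1 + w \<bullet> w" by simp
  then show ?thesis
    by (metis inner_cnj of_real_1 of_real_add of_real_mult)
qed

lemma fibre_pt_0: "fibre_pt 0 = x_elem"
  by (simp add: fibre_pt_def fibre_lin_def mat2_zero[symmetric])

text \<open>This is (|a|^2 + |b|^2)^2 = (|a|^2 - |b|^2)^2 + 4 |a b|^2.\<close>

lemma sqrt_SU11:
  assumes "(cmod a)\<^sup>2 - (cmod b)\<^sup>2 = 1"
  shows "sqrt (1 + (2 * a * b) \<bullet> (2 * a * b)) = (cmod a)\<^sup>2 + (cmod b)\<^sup>2"
proof -
  have "1 + (2 * a * b) \<bullet> (2 * a * b) = ((cmod a)\<^sup>2 + (cmod b)\<^sup>2)\<^sup>2"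
    unfolding dot_square_norm norm_mult using assms by (simp add: power_mult_distrib) algebra
  then show ?thesis by simp
qed

lemma Ad_SU11_x:
  assumes "(cmod a)\<^sup>2 - (cmod b)\<^sup>2 = 1"
  shows "Ad (mat2 a b (cnj b) (cnj a)) x_elem = fibre_pt (2 * a * b)"
proof -
  have 1: "a * cnj a - b * cnj b = 1"
    unfolding complex_norm_square[symmetric] of_real_diff[symmetric] assms by simp
  have "of_real (sqrt (1 + (2 * a * b) \<bullet> (2 * a * b))) = a * cnj a + b * cnj b"
    unfolding sqrt_SU11[OF assms] of_real_add complex_norm_square ..
  then show ?thesis
    unfolding Ad_def fibre_pt_mat2 using 1
    by (simp add: matrix_inv_mat2 x_elem_def mat2_ring mat2_eq_iff algebra_simps)
qed

text \<open>Defined and linear on all matrices, so it serves as the left inverse of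
  \<open>fibre_pt\<close> that is differentiable in the ambient space.\<close>

definition fibre_coord :: "cmat \<Rightarrow> complex" where
  "fibre_coord y = \<i> * y $ 1 $ 2"

lemma fibre_coord_fibre_pt [simp]: "fibre_coord (fibre_pt w) = w"
  by (simp add: fibre_coord_def fibre_pt_mat2)

text \<open>With w = 2 a b the square root equals |a|^2 + |b|^2, so the denominator is 2 |a|^2 = 2 a
  (cnj a) and the quotient is b / cnj a.\<close>

definition disc_of_fibre :: "complex \<Rightarrow> complex" where
  "disc_of_fibre w = inverse (1 + sqrt (1 + w \<bullet> w)) *\<^sub>R w"

definition fibre_of_disc :: "complex \<Rightarrow> complex" where
  "fibre_of_disc Z = (2 * inverse (1 - Z \<bullet> Z)) *\<^sub>R Z"

lemma inner_less_1_disc: "Z \<in> hdisc \<longleftrightarrow> Z \<bullet> Z < 1"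
  by (simp add: hdisc_def dot_square_norm abs_square_less_1)

text \<open>Since |w|^2 = s^2 - 1 = (s - 1)(s + 1), one factor s + 1 cancels against the squared
  denominator.\<close>

lemma disc_of_fibre_inner:
  obtains s where "s > 0" "sqrt (1 + w \<bullet> w) = s" "disc_of_fibre w \<bullet> disc_of_fibre w = (s - 1) / (s + 1)"
proof -
  define s where "s = sqrt (1 + w \<bullet> w)"
  then have s: "s > 0" "sqrt (1 + w \<bullet> w) = s"
    by (simp_all add: add_pos_nonneg)
  then have w: "w \<bullet> w = s * s - 1" by auto
  have "disc_of_fibre w \<bullet> disc_of_fibre w = inverse (1 + s) * (inverse (1 + s) * (s * s - 1))"
    unfolding disc_of_fibre_def s(2) by (simp add: w[symmetric])
  also have "\<dots> = (s - 1) / (s + 1)"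
    using s(1) by (simp add: divide_simps) algebra
  finally show ?thesis using that s by blast
qed

lemma disc_of_fibre_in: "disc_of_fibre w \<in> hdisc"
  by (rule disc_of_fibre_inner[of w]) (simp add: inner_less_1_disc)

text \<open>With t = |Z|^2 this is (1 - t)^2 + 4 t = (1 + t)^2.\<close>

lemma sqrt_fibre_of_disc:
  assumes "Z \<in> hdisc"
  shows "sqrt (1 + fibre_of_disc Z \<bullet> fibre_of_disc Z) = (1 + Z \<bullet> Z) * inverse (1 - Z \<bullet> Z)"
proof (rule real_sqrt_unique)
  have "1 - Z \<bullet> Z > 0" using assms by (simp add: inner_less_1_disc)
  then show "((1 + Z \<bullet> Z) * inverse (1 - Z \<bullet> Z))\<^sup>2 = 1 + fibre_of_disc Z \<bullet> fibre_of_disc Z"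
    by (simp add: fibre_of_disc_def power2_eq_square divide_simps) algebra
  show "0 \<le> (1 + Z \<bullet> Z) * inverse (1 - Z \<bullet> Z)"
    using \<open>1 - Z \<bullet> Z > 0\<close> by simp
qed

lemma disc_of_fibre_fibre_of_disc:
  assumes "Z \<in> hdisc"
  shows "disc_of_fibre (fibre_of_disc Z) = Z"
proof -
  have "1 - Z \<bullet> Z > 0" using assms by (simp add: inner_less_1_disc)
  then have "inverse (1 + (1 + Z \<bullet> Z) * inverse (1 - Z \<bullet> Z)) * (2 * inverse (1 - Z \<bullet> Z)) = 1"
    by (simp add: divide_simps)
  then show ?thesis
    unfolding disc_of_fibre_def sqrt_fibre_of_disc[OF assms] by (simp add: fibre_of_disc_def)
qed

lemma fibre_of_disc_disc_of_fibre: "fibre_of_disc (disc_of_fibre w) = w"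
proof -
  obtain s where s: "s > 0" "sqrt (1 + w \<bullet> w) = s" "disc_of_fibre w \<bullet> disc_of_fibre w = (s - 1) / (s + 1)"
    by (rule disc_of_fibre_inner)
  have "2 * inverse (1 - disc_of_fibre w \<bullet> disc_of_fibre w) * inverse (1 + s) = 1"
    unfolding s(3) using s(1) by (simp add: divide_simps)
  then show ?thesis
    unfolding fibre_of_disc_def by (simp add: disc_of_fibre_def[of w] s(2) del: inner_scaleR_left inner_scaleR_right)
qed

lemma fibre_pt_fibre_of_disc:
  assumes "Z \<in> hdisc"
  shows "\<exists>a b. (cmod a)\<^sup>2 - (cmod b)\<^sup>2 = 1 \<and> fibre_pt (fibre_of_disc Z) = Ad (mat2 a b (cnj b) (cnj a)) x_elem"
proof -
  \<comment> \<open>The phase freedom is spent on making a = r real and positive. Then b / cnj a = Z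
    gives b = r Z, and the determinant fixes r.\<close>
  define r where "r = 1 / sqrt (1 - Z \<bullet> Z)"
  have Z: "1 - Z \<bullet> Z > 0" using assms by (simp add: inner_less_1_disc)
  then have r: "r * r = inverse (1 - Z \<bullet> Z)" by (simp add: r_def field_simps)
  have 1: "(cmod (of_real r))\<^sup>2 - (cmod (of_real r * Z))\<^sup>2 = 1"
  proof -
    have "(cmod (of_real r))\<^sup>2 - (cmod (of_real r * Z))\<^sup>2 = r * r * (1 - Z \<bullet> Z)"
      by (simp add: norm_mult power_mult_distrib dot_square_norm power2_eq_square algebra_simps)
    then show ?thesis using Z r by simp
  qed
  have "2 * of_real r * (of_real r * Z) = fibre_of_disc Z"
    by (simp add: fibre_of_disc_def scaleR_conv_of_real flip: r)
  then show ?thesis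
    using Ad_SU11_x[OF 1] 1 by metis
qed

lemma orbit_SU11_eq: "orbit_SU11 = range fibre_pt"
proof
  show "orbit_SU11 \<subseteq> range fibre_pt"
    by (auto simp: orbit_SU11_def SU11_def Ad_SU11_x)
  have "fibre_pt w \<in> orbit_SU11" for w
    using fibre_pt_fibre_of_disc[OF disc_of_fibre_in[of w]] unfolding fibre_of_disc_disc_of_fibre orbit_SU11_def SU11_def by auto
  then show "range fibre_pt \<subseteq> orbit_SU11" by blast
qed

text \<open>Different pairs (a, b) give the same point, so \<open>*\<close> computes the quotient
  for an arbitrary pair from w alone.\<close>

lemma to_disc_fibre_pt: "to_disc (fibre_pt w) = disc_of_fibre w"
  unfolding to_disc_def
proof (rule the_equality)
  have *: "Z = disc_of_fibre w" if ab: "(cmod a)\<^sup>2 - (cmod b)\<^sup>2 = 1"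
    "fibre_pt w = Ad (mat2 a b (cnj b) (cnj a)) x_elem" "Z = b / cnj a" for Z a b
  proof -
    have a: "a \<noteq> 0" using ab(1) by (auto simp: power2_eq_square) (smt (verit) zero_le_square)
    have w: "w = 2 * a * b"
      using ab(2) Ad_SU11_x[OF ab(1)] fibre_coord_fibre_pt by metis
    have r: "1 + sqrt (1 + w \<bullet> w) = 2 * (cmod a)\<^sup>2"
      using sqrt_SU11[OF ab(1)] ab(1) unfolding w by linarith
    have c: "complex_of_real (2 * (cmod a)\<^sup>2) = 2 * (a * cnj a)"
      unfolding of_real_mult complex_norm_square by simp
    have "disc_of_fibre w = of_real (inverse (2 * (cmod a)\<^sup>2)) * w"
      unfolding disc_of_fibre_def r scaleR_conv_of_real by (rule refl)
    also have "\<dots> = inverse (2 * (a * cnj a)) * w"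
      unfolding of_real_inverse c by (rule refl)
    also have "\<dots> = b / cnj a"
      unfolding w using a by (simp add: divide_simps)
    finally show ?thesis using ab(3) by simp
  qed
  then show "\<And>Z. \<exists>a b. (cmod a)\<^sup>2 - (cmod b)\<^sup>2 = 1 \<and>
      fibre_pt w = Ad (mat2 a b (cnj b) (cnj a)) x_elem \<and> Z = b / cnj a \<Longrightarrow> Z = disc_of_fibre w"
    by blast
  show "\<exists>a b. (cmod a)\<^sup>2 - (cmod b)\<^sup>2 = 1 \<and>
      fibre_pt w = Ad (mat2 a b (cnj b) (cnj a)) x_elem \<and> disc_of_fibre w = b / cnj a"
    using fibre_pt_fibre_of_disc[OF disc_of_fibre_in[of w]] * unfolding fibre_of_disc_disc_of_fibre by metis
qed

lemma bij_to_disc: "bij_betw to_disc orbit_SU11 hdisc"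
  unfolding orbit_SU11_eq
  by (rule bij_betw_byWitness[where f' = "\<lambda>Z. fibre_pt (fibre_of_disc Z)"])
     (auto simp: to_disc_fibre_pt disc_of_fibre_fibre_of_disc fibre_of_disc_disc_of_fibre disc_of_fibre_in)

lemma from_disc_eq:
  assumes "Z \<in> hdisc"
  shows "from_disc Z = fibre_pt (fibre_of_disc Z)"
  unfolding from_disc_def
  using bij_to_disc assms
  by (intro inv_into_f_eq) (auto simp: bij_betw_def orbit_SU11_eq to_disc_fibre_pt disc_of_fibre_fibre_of_disc)

section \<open>The Mostow fibration\<close>

lemma scaleR_matrix_mult: "(r *\<^sub>R A) ** (s *\<^sub>R B) = (r * s) *\<^sub>R (A ** B)" for A B :: cmat
proof -
  obtain a b c d where A: "A = mat2 a b c d" by (rule mat2_cases)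
  obtain a' b' c' d' where B: "B = mat2 a' b' c' d'" by (rule mat2_cases)
  show ?thesis
    unfolding A B by (simp add: mat2_mult mat2_scaleR mat2_eq_iff scaleR_add_right mult.commute[of s r])
qed

text \<open>Even powers of B are the identity and odd powers are B, so the series separates into
  those of cosh and sinh. All elements of i m and i t are real multiples of such a B.\<close>

lemma mexp_involution:
  assumes "B ** B = mat 1"
  shows "mexp (r *\<^sub>R B) = cosh r *\<^sub>R mat 1 + sinh r *\<^sub>R B"
proof -
  have "((**) (r *\<^sub>R B) ^^ n) (mat 1) = r ^ n *\<^sub>R (if even n then mat 1 else B)" for n
  proof (induction n)
    case (Suc n)
    then show ?case by (simp add: scaleR_matrix_mult assms)
  qed simp
  then have eq: "(1 / fact n) *\<^sub>R ((**) (r *\<^sub>R B) ^^ n) (mat 1) =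
      (if even n then r ^ n /\<^sub>R fact n else 0) *\<^sub>R mat 1 + (if even n then 0 else r ^ n /\<^sub>R fact n) *\<^sub>R B" for n
    by (simp add: divide_inverse mult.commute)
  have "(\<lambda>n. (1 / fact n) *\<^sub>R ((**) (r *\<^sub>R B) ^^ n) (mat 1)) sums (cosh r *\<^sub>R mat 1 + sinh r *\<^sub>R B)"
    unfolding eq
    by (intro sums_add bounded_linear.sums[OF bounded_linear_scaleR_left] cosh_converges sinh_converges)
  then show ?thesis
    unfolding mexp_def by (rule sums_unique[symmetric])
qed

text \<open>The conjugates of real numbers are kept to match the shape of the elements of
  \<open>SU11\<close>, which brings \<open>Ad_SU11_x\<close> to bear on the Mostow factor f.\<close>

lemma mexp_i_m:
  "mexp ` cscale \<i> ` m_alg = {mat2 (of_real (cosh r)) (of_real (sinh r) * u)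
     (cnj (of_real (sinh r) * u)) (cnj (of_real (cosh r))) | r u. cmod u = 1}" (is "_ = ?R")
proof -
  have exp: "mexp (r *\<^sub>R mat2 0 u (cnj u) 0) = mat2 (of_real (cosh r)) (of_real (sinh r) * u)
     (cnj (of_real (sinh r) * u)) (cnj (of_real (cosh r)))" if "cmod u = 1" for r u
  proof -
    have "u * cnj u = 1" using that complex_norm_square[of u] by simp
    then show ?thesis
      by (subst mexp_involution) (simp_all add: mat2_ring mat2_eq_iff mult.commute, simp_all add: scaleR_conv_of_real)
  qed
  have m: "cscale \<i> ` m_alg = {mat2 0 \<beta> (cnj \<beta>) 0 | \<beta>. True}"
  proof (intro equalityI subsetI)
    fix A assume "A \<in> cscale \<i> ` m_alg"
    then obtain c where "A = cscale \<i> (mat2 0 (- cnj c) c 0)" by (auto simp: m_alg_def)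
    then have "A = mat2 0 (- \<i> * cnj c) (cnj (- \<i> * cnj c)) 0"
      by (simp add: mat2_ring)
    then show "A \<in> {mat2 0 \<beta> (cnj \<beta>) 0 | \<beta>. True}" by blast
  next
    fix A assume "A \<in> {mat2 0 \<beta> (cnj \<beta>) 0 | \<beta>. True}"
    then obtain \<beta> where "A = mat2 0 \<beta> (cnj \<beta>) 0" by blast
    then have "A = cscale \<i> (mat2 0 (- cnj (- \<i> * cnj \<beta>)) (- \<i> * cnj \<beta>) 0)"
      by (simp add: mat2_ring mat2_eq_iff)
    then show "A \<in> cscale \<i> ` m_alg" unfolding m_alg_def by blast
  qed
  show ?thesis
  proof (intro equalityI subsetI)
    fix f assume "f \<in> mexp ` cscale \<i> ` m_alg"
    then obtain \<beta> where f: "f = mexp (mat2 0 \<beta> (cnj \<beta>) 0)" unfolding m by blast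
    \<comment> \<open>Since \<open>sgn 0 = 0\<close> is not a unit, the zero matrix gets an
      arbitrary direction.\<close>
    define u where "u = (if \<beta> = 0 then 1 else sgn \<beta>)"
    have "cmod u = 1" "\<beta> = cmod \<beta> *\<^sub>R u"
      by (simp_all add: u_def norm_sgn sgn_div_norm)
    moreover from this have "mat2 0 \<beta> (cnj \<beta>) 0 = cmod \<beta> *\<^sub>R mat2 0 u (cnj u) 0"
      by (metis mat2_scaleR complex_cnj_scaleR scaleR_zero_right)
    ultimately show "f \<in> ?R" unfolding f using exp by force
  next
    fix f assume "f \<in> ?R"
    then obtain r u where u: "cmod u = 1" "f = mexp (r *\<^sub>R mat2 0 u (cnj u) 0)"
      using exp by force
    have "r *\<^sub>R mat2 0 u (cnj u) 0 = mat2 0 (r *\<^sub>R u) (cnj (r *\<^sub>R u)) 0"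
      by (simp add: mat2_scaleR)
    then show "f \<in> mexp ` cscale \<i> ` m_alg"
      unfolding m u(2) by blast
  qed
qed

lemma Ad_exp_i_m:
  assumes "f \<in> mexp ` cscale \<i> ` m_alg"
  shows "f \<in> SL2C" "Ad f x_elem \<in> range fibre_pt"
proof -
  obtain r u where u: "cmod u = 1" and f: "f = mat2 (of_real (cosh r)) (of_real (sinh r) * u)
     (cnj (of_real (sinh r) * u)) (cnj (of_real (cosh r)))"
    using assms unfolding mexp_i_m by blast
  have 1: "(cmod (of_real (cosh r)))\<^sup>2 - (cmod (of_real (sinh r) * u))\<^sup>2 = 1"
    by (simp add: norm_mult u cosh_square_eq)
  show "f \<in> SL2C"
    using arg_cong[OF 1, of complex_of_real] unfolding f SL2C_def of_real_diff complex_norm_square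
    by (simp add: mat2_det)
  show "Ad f x_elem \<in> range fibre_pt"
    unfolding f Ad_SU11_x[OF 1] by blast
qed

lemma fibre_pt_exp_i_m: "\<exists>f \<in> mexp ` cscale \<i> ` m_alg. fibre_pt w = Ad f x_elem"
proof -
  define u where "u = (if w = 0 then 1 else sgn w)"
  have u: "cmod u = 1" "w = cmod w *\<^sub>R u"
    by (simp_all add: u_def norm_sgn sgn_div_norm)
  \<comment> \<open>With a = cosh r and b = u sinh r, the parameter 2 a b is u sinh (2 r); this has
    to be w.\<close>
  define r where "r = arsinh (cmod w) / 2"
  have "2 * cosh r * sinh r = cmod w"
    using sinh_double[of r] by (simp add: r_def mult.commute mult.left_commute)
  then have w: "2 * of_real (cosh r) * (of_real (sinh r) * u) = w"
    using u(2) by (metis mult.assoc of_real_mult of_real_numeral scaleR_conv_of_real)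
  have 1: "(cmod (of_real (cosh r)))\<^sup>2 - (cmod (of_real (sinh r) * u))\<^sup>2 = 1"
    by (simp add: norm_mult u(1) cosh_square_eq)
  show ?thesis
    unfolding mexp_i_m
    by (intro bexI[where P = "\<lambda>f. fibre_pt w = Ad f x_elem", OF Ad_SU11_x[OF 1, unfolded w, symmetric]])
       (use u(1) in blast)
qed

text \<open>Diagonal matrices commute with x, so the last Mostow factor leaves no trace in the
  orbit.\<close>

lemma exp_i_t:
  assumes "e \<in> mexp ` cscale \<i> ` t_alg"
  shows "e \<in> SL2C" "Ad e x_elem = x_elem"
proof -
  obtain \<theta> where "e = mexp (cscale \<i> (mat2 (\<i> * of_real \<theta>) 0 0 (- (\<i> * of_real \<theta>))))"
    using assms by (auto simp: t_alg_def)
  also have "cscale \<i> (mat2 (\<i> * of_real \<theta>) 0 0 (- (\<i> * of_real \<theta>))) = (- \<theta>) *\<^sub>R mat2 1 0 0 (-1)"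
    by (simp add: mat2_ring mat2_eq_iff) (simp add: scaleR_conv_of_real)
  finally have e: "e = mat2 (of_real (cosh \<theta> - sinh \<theta>)) 0 0 (of_real (cosh \<theta> + sinh \<theta>))"
    by (subst (asm) mexp_involution) (simp_all add: mat2_ring mat2_eq_iff, simp_all add: scaleR_conv_of_real)
  have 1: "complex_of_real (cosh \<theta> - sinh \<theta>) * of_real (cosh \<theta> + sinh \<theta>) = 1"
    by (simp add: cosh_plus_sinh cosh_minus_sinh exp_minus flip: of_real_mult)
  show "e \<in> SL2C"
    unfolding e SL2C_def using 1 by (simp add: mat2_det del: of_real_add of_real_diff)
  show "Ad e x_elem = x_elem"
    unfolding e Ad_def x_elem_def using 1
    by (simp add: mat2_ring mat2_eq_iff matrix_inv_mat2 mult.commute mult.left_commute del: of_real_add of_real_diff)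
qed

lemma one_exp_i_t: "mat 1 \<in> mexp ` cscale \<i> ` t_alg"
proof -
  have "mexp (0 *\<^sub>R mat 1) = mat 1" by (subst mexp_involution) simp_all
  moreover have "(0 :: real) *\<^sub>R mat 1 = cscale \<i> (mat2 (\<i> * of_real 0) 0 0 (- (\<i> * of_real 0)))"
    by (simp add: mat2_ring)
  ultimately show ?thesis
    unfolding t_alg_def by (metis (mono_tags, lifting) CollectI image_eqI)
qed

section \<open>Equivariance of the skew-Hermitian part and the Mostow projection\<close>

definition skew :: "cmat \<Rightarrow> cmat" where
  "skew y = (1/2) *\<^sub>R (y - adj y)"

text \<open>On traceless skew-Hermitian matrices the determinant is the square of an invariant
  Euclidean norm.\<close>

definition skew_norm :: "cmat \<Rightarrow> real" where
  "skew_norm y = sqrt (Re (det (skew y)))"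

text \<open>On the complex orbit this is the Mostow projection without any decomposition: it
  commutes with SU(2) and takes the value x on the whole fibre over x.\<close>

definition skew_dir :: "cmat \<Rightarrow> cmat" where
  "skew_dir y = (1 / skew_norm y) *\<^sub>R skew y"

lemma skew_Ad: "k \<in> SU2 \<Longrightarrow> skew (Ad k y) = Ad k (skew y)"
  by (simp add: skew_def Ad_scaleR Ad_diff Ad_adj)

lemma skew_norm_Ad: "k \<in> SU2 \<Longrightarrow> skew_norm (Ad k y) = skew_norm y"
  by (simp add: skew_norm_def skew_Ad det_Ad SU2_SL2C)

lemma skew_dir_Ad: "k \<in> SU2 \<Longrightarrow> skew_dir (Ad k y) = Ad k (skew_dir y)"
  by (simp add: skew_dir_def skew_Ad skew_norm_Ad Ad_scaleR)

lemma skew_fibre_pt: "skew (fibre_pt w) = sqrt (1 + w \<bullet> w) *\<^sub>R x_elem"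
  by (simp add: skew_def fibre_pt_mat2 x_elem_def mat2_ring mat2_eq_iff) (simp add: scaleR_conv_of_real)

lemma skew_norm_fibre_pt: "skew_norm (fibre_pt w) = sqrt (1 + w \<bullet> w)"
  by (simp add: skew_norm_def skew_fibre_pt x_elem_def mat2_ring)

lemma skew_dir_fibre_pt: "skew_dir (fibre_pt w) = x_elem"
proof -
  have "sqrt (1 + w \<bullet> w) > 0" by (simp add: add_pos_nonneg)
  then show ?thesis
    by (simp add: skew_dir_def skew_fibre_pt skew_norm_fibre_pt)
qed

lemma det_fibre_pt: "det (fibre_pt w) = 1" and trace_fibre_pt: "trace (fibre_pt w) = 0"
  using of_real_sqrt_inner[of w] by (simp_all add: fibre_pt_mat2 mat2_ring algebra_simps)

lemma fibre_pt_of_skew: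
  assumes "trace y = 0" "det y = 1" "skew y = c *\<^sub>R x_elem" "c > 0"
  shows "y \<in> range fibre_pt"
proof -
  obtain p q r t where y: "y = mat2 p q r t" by (rule mat2_cases)
  have t: "t = - p" using assms(1) by (simp add: y mat2_trace eq_neg_iff_add_eq_0 add.commute)
  have "q = cnj r" "(1/2) *\<^sub>R (p - cnj p) = c *\<^sub>R \<i>"
    using arg_cong[OF assms(3), of "\<lambda>A. A $ 1 $ 2"] arg_cong[OF assms(3), of "\<lambda>A. A $ 1 $ 1"]
    by (simp_all add: skew_def y x_elem_def mat2_adj mat2_diff mat2_scaleR)
  then have r: "r = cnj q" and p: "Im p = c"
    by (simp_all add: complex_eq_iff)
  have det: "- p * p - q * cnj q = 1"
    using assms(2) by (simp add: y mat2_det t r)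
  \<comment> \<open>The imaginary part of the determinant is -2 c Re p. Its real part then gives c^2
    = 1 + |q|^2, and c > 0 selects the positive root.\<close>
  then have "Re p = 0"
    using assms(4) p by (simp add: complex_eq_iff)
  then have p': "p = \<i> * of_real c" using p by (simp add: complex_eq_iff)
  have "of_real (c * c) = complex_of_real (1 + (\<i> * q) \<bullet> (\<i> * q))"
    unfolding of_real_add inner_cnj using det by (simp add: p' algebra_simps)
  then have "c * c = 1 + (\<i> * q) \<bullet> (\<i> * q)" by (simp only: of_real_eq_iff)
  then have "sqrt (1 + (\<i> * q) \<bullet> (\<i> * q)) = c"
    using assms(4) by (intro real_sqrt_unique) (simp_all add: power2_eq_square)
  then have "y = fibre_pt (\<i> * q)"
    by (simp add: fibre_pt_mat2 y t r p' mat2_eq_iff)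
  then show ?thesis by blast
qed

text \<open>A section of the Hopf map that sends (\<alpha>, \<beta>) to (|\<alpha>|^2 - |\<beta>|^2,
  -2 i \<alpha> \<beta>). Taking \<alpha> real and positive works except at the pole a = -1, where
  \<alpha> vanishes and \<beta> cannot be found by division.\<close>

lemma SU2_transitive:
  assumes "trace A = 0" "adj A = - A" "det A = 1"
  shows "\<exists>k\<in>SU2. A = Ad k x_elem"
proof -
  obtain p q r t where A: "A = mat2 p q r t" by (rule mat2_cases)
  have t: "t = - p" using assms(1) by (simp add: A mat2_trace eq_neg_iff_add_eq_0 add.commute)
  have "cnj q = - r" "cnj p = - p"
    using arg_cong[OF assms(2), of "\<lambda>A. A $ 2 $ 1"] arg_cong[OF assms(2), of "\<lambda>A. A $ 1 $ 1"]
    by (simp_all add: A mat2_adj mat2_uminus)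
  then have r: "r = - cnj q" and p: "Re p = 0"
    by (simp_all add: complex_eq_iff)
  define a where "a = Im p"
  have p: "p = \<i> * of_real a" using p by (simp add: a_def complex_eq_iff)
  have "\<i> * complex_of_real a * (\<i> * of_real a) = - (of_real a * of_real a)"
    by (simp add: complex_eq_iff)
  then have "complex_of_real (a * a + q \<bullet> q) = 1"
    using assms(3) unfolding of_real_add inner_cnj by (simp add: A mat2_det t r p)
  then have a: "a * a + q \<bullet> q = 1" by (simp only: of_real_eq_1_iff)
  have Ad: "mat2 \<alpha> \<beta> (- cnj \<beta>) (cnj \<alpha>) \<in> SU2 \<and> Ad (mat2 \<alpha> \<beta> (- cnj \<beta>) (cnj \<alpha>)) x_elem = A"
    if "\<alpha> * cnj \<alpha> + \<beta> * cnj \<beta> = 1" "of_real a = \<alpha> * cnj \<alpha> - \<beta> * cnj \<beta>" "q = - 2 * \<i> * \<alpha> * \<beta>" for \<alpha> \<beta>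
    using that(1) mat2_in_SU2[OF that(1)] unfolding A t r p that(2,3) Ad_def x_elem_def
    by (simp add: matrix_inv_mat2 mat2_ring mat2_eq_iff algebra_simps)
  show ?thesis
  proof (cases "a = -1")
    case True
    then have "q = 0" using a by simp
    with True Ad[of 0 1] show ?thesis by auto
  next
    case False
    have "a * a \<le> 1" using a inner_ge_zero[of q] by linarith
    have "\<bar>a\<bar> \<le> 1"
      using \<open>a * a \<le> 1\<close> abs_le_square_iff[of a 1] by (simp add: power2_eq_square)
    then have "1 + a > 0" using False by linarith
    define \<alpha> where "\<alpha> = sqrt ((1 + a) / 2)"
    have \<alpha>: "\<alpha> > 0" "\<alpha> * \<alpha> = (1 + a) / 2" using \<open>1 + a > 0\<close> by (simp_all add: \<alpha>_def)
    define \<beta> where "\<beta> = \<i> * q / (2 * of_real \<alpha>)"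
    have \<beta>: "q = - 2 * \<i> * of_real \<alpha> * \<beta>" using \<alpha>(1) by (simp add: \<beta>_def)
    have "\<beta> \<bullet> \<beta> = q \<bullet> q / (4 * (\<alpha> * \<alpha>))"
      using \<alpha>(1) by (simp add: \<beta>_def dot_square_norm norm_divide norm_mult power_divide power_mult_distrib power2_eq_square)
    also have "\<dots> = (1 - a) / 2"
      using a \<open>1 + a > 0\<close> unfolding \<alpha>(2) by (simp add: divide_simps) algebra
    finally have \<beta>': "\<beta> * cnj \<beta> = of_real ((1 - a) / 2)"
      by (metis inner_cnj)
    have \<alpha>': "of_real \<alpha> * cnj (of_real \<alpha>) = complex_of_real ((1 + a) / 2)"
      by (simp only: complex_cnj_complex_of_real of_real_mult[symmetric] \<alpha>(2))
    have "of_real \<alpha> * cnj (of_real \<alpha>) + \<beta> * cnj \<beta> = 1" "of_real a = of_real \<alpha> * cnj (of_real \<alpha>) - \<beta> * cnj \<beta>"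
      unfolding \<alpha>' \<beta>' of_real_add[symmetric] of_real_diff[symmetric] by (simp_all add: field_simps)
    from Ad[OF this \<beta>] show ?thesis by metis
  qed
qed

text \<open>The skew-Hermitian part never vanishes, so it can be normalised and rotated to x by
  SU(2). What remains after undoing the rotation lies in the fibre.\<close>

lemma mostow_decomposition:
  assumes "trace y = 0" "det y = 1"
  shows "\<exists>k\<in>SU2. \<exists>w. y = Ad k (fibre_pt w)"
proof -
  obtain p q r t where y: "y = mat2 p q r t" by (rule mat2_cases)
  have t: "t = - p" using assms(1) by (simp add: y mat2_trace eq_neg_iff_add_eq_0 add.commute)
  \<comment> \<open>The two squares are minus the determinant of the Hermitian part, which is
    negative semidefinite on traceless matrices.\<close>
  have "Re (det (skew y)) = Re (det y) + (Re p)\<^sup>2 + (cmod (q + cnj r))\<^sup>2 / 4"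
    unfolding cmod_power2 by (simp add: skew_def y t mat2_ring power2_eq_square field_simps)
  then have pos: "Re (det (skew y)) > 0"
    by (simp add: assms(2) add_pos_nonneg)
  have "Im (det (skew y)) = 0"
    by (simp add: skew_def y t mat2_ring algebra_simps)
  then have det: "det (skew y) = of_real (skew_norm y * skew_norm y)"
    using pos by (simp add: skew_norm_def complex_eq_iff)
  have len: "skew_norm y > 0" using pos by (simp add: skew_norm_def)
  have "det (skew_dir y) = (1 / skew_norm y * (1 / skew_norm y)) *\<^sub>R det (skew y)"
    by (simp add: skew_dir_def det_2 algebra_simps)
  then have "det (skew_dir y) = 1"
    using len unfolding det by (simp add: scaleR_conv_of_real)
  moreover have "trace (skew_dir y) = 0" "adj (skew_dir y) = - skew_dir y"
    by (simp_all add: skew_dir_def skew_def y t mat2_ring mat2_eq_iff algebra_simps)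
  ultimately obtain k where k: "k \<in> SU2" "skew_dir y = Ad k x_elem"
    using SU2_transitive by blast
  let ?l = "matrix_inv k"
  have l: "?l \<in> SU2"
    using k(1) matrix_inv_SU2[OF k(1)] SL2C_inverse[OF SU2_SL2C[OF k(1)]]
    by (simp add: SU2_def SL2C_def flip: adj_def)
  have "skew (Ad ?l y) = skew_norm y *\<^sub>R Ad ?l (skew_dir y)"
    unfolding skew_Ad[OF l] skew_dir_def Ad_scaleR using len by simp
  also have "\<dots> = skew_norm y *\<^sub>R x_elem"
    by (simp add: k(2) Ad_inverse[OF SU2_SL2C[OF k(1)]])
  finally have "Ad ?l y \<in> range fibre_pt"
    using assms len by (intro fibre_pt_of_skew[of _ "skew_norm y"]) (simp_all add: trace_Ad det_Ad SU2_SL2C l)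
  then show ?thesis
    by (metis Ad_inverse(1) SU2_SL2C k(1) rangeE)
qed

lemma Ad_fibre_pt_orbit:
  assumes "k \<in> SU2"
  shows "Ad k (fibre_pt w) \<in> orbit_SL2C"
proof -
  obtain f where f: "f \<in> mexp ` cscale \<i> ` m_alg" "fibre_pt w = Ad f x_elem"
    using fibre_pt_exp_i_m by blast
  have "Ad k (fibre_pt w) = Ad (k ** f) x_elem"
    using Ad_mult[OF SU2_SL2C[OF assms] Ad_exp_i_m(1)[OF f(1)]] f(2) by simp
  then show ?thesis
    unfolding orbit_SL2C_def using SL2C_mult[OF SU2_SL2C[OF assms] Ad_exp_i_m(1)[OF f(1)]] by blast
qed

text \<open>Two equations that can be tested on a curve and differentiated along it.\<close>

lemma orbit_SL2C_iff: "y \<in> orbit_SL2C \<longleftrightarrow> trace y = 0 \<and> det y = 1"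
proof
  assume "y \<in> orbit_SL2C"
  then show "trace y = 0 \<and> det y = 1"
    by (auto simp: orbit_SL2C_def trace_Ad det_Ad x_elem_def mat2_ring)
next
  assume "trace y = 0 \<and> det y = 1"
  then show "y \<in> orbit_SL2C"
    using mostow_decomposition Ad_fibre_pt_orbit by metis
qed

lemma orbit_SL2C_cases:
  assumes "y \<in> orbit_SL2C"
  obtains k w where "k \<in> SU2" "y = Ad k (fibre_pt w)"
  using assms mostow_decomposition unfolding orbit_SL2C_iff by blast

lemma mostow_proj_Ad_fibre_pt:
  assumes "k \<in> SU2"
  shows "mostow_proj (Ad k (fibre_pt w)) = Ad k x_elem"
  unfolding mostow_proj_def
proof (rule the_equality)
  obtain f where f: "f \<in> mexp ` cscale \<i> ` m_alg" "fibre_pt w = Ad f x_elem"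
    using fibre_pt_exp_i_m by blast
  have "Ad k (fibre_pt w) = Ad (k ** f ** mat 1) x_elem"
    using Ad_mult[OF SU2_SL2C[OF assms] Ad_exp_i_m(1)[OF f(1)]] f(2) by simp
  then show "\<exists>k'\<in>SU2. \<exists>f\<in>mexp ` cscale \<i> ` m_alg. \<exists>e\<in>mexp ` cscale \<i> ` t_alg.
      Ad k (fibre_pt w) = Ad (k' ** f ** e) x_elem \<and> Ad k x_elem = Ad k' x_elem"
    using assms f(1) one_exp_i_t by blast
next
  fix p
  assume "\<exists>k'\<in>SU2. \<exists>f\<in>mexp ` cscale \<i> ` m_alg. \<exists>e\<in>mexp ` cscale \<i> ` t_alg.
      Ad k (fibre_pt w) = Ad (k' ** f ** e) x_elem \<and> p = Ad k' x_elem"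
  then obtain k' f e where *: "k' \<in> SU2" "f \<in> mexp ` cscale \<i> ` m_alg" "e \<in> mexp ` cscale \<i> ` t_alg"
    "Ad k (fibre_pt w) = Ad (k' ** f ** e) x_elem" "p = Ad k' x_elem" by blast
  obtain w' where w': "Ad f x_elem = fibre_pt w'" using Ad_exp_i_m(2)[OF *(2)] by blast
  have "Ad (k' ** f ** e) x_elem = Ad k' (fibre_pt w')"
    using Ad_mult[OF SL2C_mult[OF SU2_SL2C[OF *(1)] Ad_exp_i_m(1)[OF *(2)]] exp_i_t(1)[OF *(3)]]
      Ad_mult[OF SU2_SL2C[OF *(1)] Ad_exp_i_m(1)[OF *(2)]] exp_i_t(2)[OF *(3)] w' by simp
  \<comment> \<open>Instead of comparing the factors of two decompositions, apply the equivariant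
    map \<open>skew_dir\<close>, which sees only Ad k x and Ad k' x.\<close>
  then have "skew_dir (Ad k (fibre_pt w)) = skew_dir (Ad k' (fibre_pt w'))" using *(4) by simp
  then show "p = Ad k x_elem"
    by (simp add: skew_dir_Ad skew_dir_fibre_pt assms *(1,5))
qed

lemma mat_1_SU2: "mat 1 \<in> SU2"
  using mat2_in_SU2[of 1 0] by (simp add: mat2_one)

lemma mostow_fibre_x: "mostow_fibre x_elem = range fibre_pt"
proof (intro equalityI subsetI)
  fix y assume "y \<in> mostow_fibre x_elem"
  then have y: "y \<in> orbit_SL2C" "mostow_proj y = x_elem" by (simp_all add: mostow_fibre_def)
  obtain k w where k: "k \<in> SU2" "y = Ad k (fibre_pt w)" using y(1) by (rule orbit_SL2C_cases)
  \<comment> \<open>Here k may be any element of the stabiliser of x. That is enough to keep the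
    skew-Hermitian part a positive multiple of x.\<close>
  have x: "Ad k x_elem = x_elem" using y(2) by (simp add: k mostow_proj_Ad_fibre_pt)
  show "y \<in> range fibre_pt"
    using y(1) unfolding orbit_SL2C_iff
    by (intro fibre_pt_of_skew[of y "sqrt (1 + w \<bullet> w)"])
       (simp_all add: k skew_Ad skew_fibre_pt Ad_scaleR x add_pos_nonneg)
next
  fix y assume "y \<in> range fibre_pt"
  then obtain w where "y = Ad (mat 1) (fibre_pt w)" by auto
  then show "y \<in> mostow_fibre x_elem"
    unfolding mostow_fibre_def
    using Ad_fibre_pt_orbit[OF mat_1_SU2] mostow_proj_Ad_fibre_pt[OF mat_1_SU2] by auto
qed

section \<open>The structure on the complex orbit\<close>

lemma cmat_add_rdistrib: "(A + B) ** C = A ** C + B ** C" for A B C :: cmat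
  by (simp add: cmat_eq_iff matrix_matrix_mult_def sum_2 distrib_right)

lemma trace_linear: "trace (A + B) = trace A + trace B" "trace (r *\<^sub>R A) = r *\<^sub>R trace A"
  for A B :: cmat
  by (simp_all add: trace_def sum_2 scaleR_add_right)

lemma commut_linear:
  "commut (A + B) C = commut A C + commut B C" "commut C (A + B) = commut C A + commut C B"
  "commut (r *\<^sub>R A) C = r *\<^sub>R commut A C" "commut C (r *\<^sub>R A) = r *\<^sub>R commut C A"
proof -
  obtain a b c d where A: "A = mat2 a b c d" by (rule mat2_cases)
  obtain a' b' c' d' where B: "B = mat2 a' b' c' d'" by (rule mat2_cases)
  obtain a'' b'' c'' d'' where C: "C = mat2 a'' b'' c'' d''" by (rule mat2_cases)
  show "commut (A + B) C = commut A C + commut B C" "commut C (A + B) = commut C A + commut C B"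
    "commut (r *\<^sub>R A) C = r *\<^sub>R commut A C" "commut C (r *\<^sub>R A) = r *\<^sub>R commut C A"
    unfolding A B C by (simp_all add: mat2_ring mat2_eq_iff algebra_simps)
qed

lemma cscale_linear:
  "cscale (z + z') A = cscale z A + cscale z' A" "cscale (r *\<^sub>R z) A = r *\<^sub>R cscale z A"
  by (simp_all add: cmat_eq_iff cscale_def map_matrix_def algebra_simps)

lemma cscale_zero_right [simp]: "cscale z 0 = 0"
  by (simp add: cmat_eq_iff cscale_def map_matrix_def)

lemma commut_zero [simp]: "commut 0 A = 0" "commut A 0 = 0"
  using commut_linear(3,4)[where r = 0] by simp_all

text \<open>Both terms are visibly \<open>SU(2)\<close>-equivariant in \<open>(y, v)\<close>, so comparison with \<open>I2\<close> reduces to the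
  fibre over \<open>x\<close>, where \<open>skew_dir y = x\<close>. There the commutator is the part of \<open>I2 y v\<close> orthogonal to
  \<open>x\<close>, and the multiple of \<open>x\<close> is what tangency to the orbit then forces.\<close>

definition I2_formula :: "cmat \<Rightarrow> cmat \<Rightarrow> cmat" where
  "I2_formula y v = (- 1 / 2) *\<^sub>R commut (skew_dir y) (adj v) +
     cscale ((- 1 / (4 * skew_norm y)) *\<^sub>R trace (commut (adj v) y ** skew_dir y)) (skew_dir y)"

lemma I2_formula_Ad:
  assumes "k \<in> SU2"
  shows "I2_formula (Ad k y) (Ad k v) = Ad k (I2_formula y v)"
  using SU2_SL2C[OF assms]
  by (simp add: I2_formula_def skew_dir_Ad skew_norm_Ad assms Ad_add Ad_diff Ad_scaleR Ad_cscale Ad_commut trace_Ad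
      flip: Ad_adj[OF assms] Ad_matrix_mult Ad_commut)

lemma I2_formula_linear: "I2_formula y (a *\<^sub>R u + b *\<^sub>R v) = a *\<^sub>R I2_formula y u + b *\<^sub>R I2_formula y v"
proof -
  have "commut (adj (a *\<^sub>R u + b *\<^sub>R v)) y ** skew_dir y =
      a *\<^sub>R (commut (adj u) y ** skew_dir y) + b *\<^sub>R (commut (adj v) y ** skew_dir y)"
    using scaleR_matrix_mult[of _ _ 1 "skew_dir y"]
    by (simp add: adj_add adj_scaleR commut_linear cmat_add_rdistrib)
  then have t: "trace (commut (adj (a *\<^sub>R u + b *\<^sub>R v)) y ** skew_dir y) =
      a *\<^sub>R trace (commut (adj u) y ** skew_dir y) + b *\<^sub>R trace (commut (adj v) y ** skew_dir y)"
    by (simp add: trace_linear)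
  have c: "cscale (c *\<^sub>R (a *\<^sub>R z + b *\<^sub>R z')) n = a *\<^sub>R cscale (c *\<^sub>R z) n + b *\<^sub>R cscale (c *\<^sub>R z') n"
    for c z z' n
    by (simp add: scaleR_add_right cscale_linear mult.commute)
  show ?thesis
    unfolding I2_formula_def t c unfolding adj_add adj_scaleR commut_linear by (simp only: scaleR_add_right scaleR_left_commute ac_simps)
qed

text \<open>On m + i m the structure exchanges \<beta> and \<gamma> and conjugates them, which is
  why the formula contains \<open>adj v\<close>. As s is nonzero, the off-diagonal part of v
  determines \<beta> and \<gamma>.\<close>

lemma I2_formula_fibre_pt:
  "I2_formula (fibre_pt w) (commut (off_diag \<beta> \<gamma>) (fibre_pt w)) = commut (off_diag (- \<i> * cnj \<gamma>) (\<i> * cnj \<beta>)) (fibre_pt w)"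
proof -
  define s where "s = sqrt (1 + w \<bullet> w)"
  have s: "s \<noteq> 0" using add_pos_nonneg[of 1 "w \<bullet> w"] by (simp add: s_def)
  let ?y = "mat2 (\<i> * of_real s) (- (\<i> * w)) (\<i> * cnj w) (- (\<i> * of_real s))"
  \<comment> \<open>The factor 4 s is what the constant - 1 / (4 s) in \<open>I2_formula\<close>
    cancels; s is the value of \<open>skew_norm\<close> here.\<close>
  have T: "trace (commut (adj (commut (off_diag \<beta> \<gamma>) ?y)) ?y ** x_elem) =
      (4 * s) *\<^sub>R (\<i> * (cnj \<gamma> * cnj w - w * cnj \<beta>))"
    by (simp add: off_diag_def x_elem_def mat2_ring algebra_simps) (simp add: scaleR_conv_of_real)
  have t: "(- 1 / (4 * s)) *\<^sub>R trace (commut (adj (commut (off_diag \<beta> \<gamma>) ?y)) ?y ** x_elem) =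
      - \<i> * (cnj \<gamma> * cnj w - w * cnj \<beta>)"
    unfolding T scaleR_scaleR using s by simp
  show ?thesis
    unfolding I2_formula_def skew_dir_fibre_pt skew_norm_fibre_pt unfolding fibre_pt_mat2 s_def[symmetric] t
    by (simp add: off_diag_def x_elem_def mat2_ring mat2_eq_iff algebra_simps) (simp add: scaleR_conv_of_real)
qed

lemma half_ad_x_off_diag: "half_ad_x (off_diag \<beta> \<gamma>) = off_diag (\<i> * \<beta>) (- (\<i> * \<gamma>))"
  by (simp add: half_ad_x_def x_elem_def off_diag_def mat2_ring mat2_eq_iff)

text \<open>Half of ad x on m and its negative on i m combine into the one conjugate linear rule
  that takes (\<beta>, \<gamma>) to (- i cnj \<gamma>, i cnj \<beta>).\<close>

lemma X_field_rep:
  assumes "d = mat2 0 (- cnj c) c 0" "e = mat2 0 (- cnj c') c' 0"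
  shows "X_field d y + X_field (cscale \<i> e) y = commut (off_diag (- cnj c - \<i> * cnj c') (c + \<i> * c')) y"
    and "X_field (half_ad_x d) y - X_field (half_ad_x (cscale \<i> e)) y =
      commut (off_diag (- \<i> * cnj (c + \<i> * c')) (\<i> * cnj (- cnj c - \<i> * cnj c'))) y"
proof -
  obtain p q r t where y: "y = mat2 p q r t" by (rule mat2_cases)
  show "X_field d y + X_field (cscale \<i> e) y = commut (off_diag (- cnj c - \<i> * cnj c') (c + \<i> * c')) y"
    unfolding assms y by (simp add: X_field_def off_diag_def mat2_ring mat2_eq_iff algebra_simps)
  show "X_field (half_ad_x d) y - X_field (half_ad_x (cscale \<i> e)) y =
      commut (off_diag (- \<i> * cnj (c + \<i> * c')) (\<i> * cnj (- cnj c - \<i> * cnj c'))) y"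
    unfolding assms y mat2_cscale mult_zero_right half_ad_x_off_diag[unfolded off_diag_def]
    by (simp add: X_field_def off_diag_def mat2_ring mat2_eq_iff algebra_simps)
qed

lemma I2_formula_X_field:
  assumes "k \<in> SU2" "y \<in> range fibre_pt" "d \<in> m_alg" "e \<in> m_alg"
  shows "I2_formula (Ad k y) (Ad k (X_field d y + X_field (cscale \<i> e) y)) =
    Ad k (X_field (half_ad_x d) y - X_field (half_ad_x (cscale \<i> e)) y)"
proof -
  obtain c c' where "d = mat2 0 (- cnj c) c 0" "e = mat2 0 (- cnj c') c' 0"
    using assms(3,4) by (auto simp: m_alg_def)
  note rep = X_field_rep[OF this]
  obtain w where "y = fibre_pt w" using assms(2) by blast
  then show ?thesis
    unfolding rep I2_formula_Ad[OF assms(1)] by (simp only: I2_formula_fibre_pt)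
qed

lemma X_field_rep_exists:
  "\<exists>d\<in>m_alg. \<exists>e\<in>m_alg. X_field d y + X_field (cscale \<i> e) y = commut (off_diag \<beta> \<gamma>) y"
proof -
  \<comment> \<open>The skew-Hermitian part of \<open>off_diag \<beta> \<gamma>\<close> is d, and
    its Hermitian part is i e.\<close>
  define c c' where "c = (\<gamma> - cnj \<beta>) / 2" and "c' = - \<i> * (\<gamma> + cnj \<beta>) / 2"
  have "- cnj c - \<i> * cnj c' = \<beta>" "c + \<i> * c' = \<gamma>"
    by (simp_all add: c_def c'_def complex_eq_iff field_simps)
  then show ?thesis
    using X_field_rep(1)[of _ c _ c' y, OF refl refl] unfolding m_alg_def by blast
qed

text \<open>Uniqueness in the description is automatic: \<open>I2_formula_X_field\<close> evaluates
  every admissible choice of k, y', d, e to an expression in y and v.\<close>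

lemma I2_Ad_fibre_pt:
  assumes "k \<in> SU2" "y = Ad k (fibre_pt w)" "v = Ad k (commut (off_diag \<beta> \<gamma>) (fibre_pt w))"
  shows "I2 y v = I2_formula y v"
  unfolding I2_def
proof (rule the_equality)
  obtain d e where de: "d \<in> m_alg" "e \<in> m_alg"
    "X_field d (fibre_pt w) + X_field (cscale \<i> e) (fibre_pt w) = commut (off_diag \<beta> \<gamma>) (fibre_pt w)"
    using X_field_rep_exists by blast
  show "\<exists>k\<in>SU2. \<exists>y'\<in>mostow_fibre x_elem. \<exists>d\<in>m_alg. \<exists>e\<in>m_alg.
     y = Ad k y' \<and>
     v = Ad k (X_field d y' + X_field (cscale \<i> e) y') \<and>
     I2_formula y v = Ad k (X_field (half_ad_x d) y' - X_field (half_ad_x (cscale \<i> e)) y')"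
    using assms(1) de(1,2) I2_formula_X_field[OF assms(1) rangeI de(1,2)]
    unfolding mostow_fibre_x assms(2,3) de(3)[symmetric] by blast
next
  fix u
  assume "\<exists>k\<in>SU2. \<exists>y'\<in>mostow_fibre x_elem. \<exists>d\<in>m_alg. \<exists>e\<in>m_alg.
     y = Ad k y' \<and>
     v = Ad k (X_field d y' + X_field (cscale \<i> e) y') \<and>
     u = Ad k (X_field (half_ad_x d) y' - X_field (half_ad_x (cscale \<i> e)) y')"
  then obtain k y' d e where *: "k \<in> SU2" "y' \<in> range fibre_pt" "d \<in> m_alg" "e \<in> m_alg"
    "y = Ad k y'" "v = Ad k (X_field d y' + X_field (cscale \<i> e) y')"
    "u = Ad k (X_field (half_ad_x d) y' - X_field (half_ad_x (cscale \<i> e)) y')"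
    unfolding mostow_fibre_x by blast
  show "u = I2_formula y v"
    unfolding *(5-7) I2_formula_X_field[OF *(1-4)] by (rule refl)
qed

section \<open>The tangent spaces of the complex orbit\<close>

lemma commut_off_diag_fibre_pt:
  "commut (off_diag \<beta> \<gamma>) (fibre_pt w) =
    mat2 (\<i> * (\<beta> * cnj w + w * \<gamma>)) (- 2 * \<i> * of_real (sqrt (1 + w \<bullet> w)) * \<beta>)
      (2 * \<i> * of_real (sqrt (1 + w \<bullet> w)) * \<gamma>) (- (\<i> * (\<beta> * cnj w + w * \<gamma>)))"
  by (simp add: fibre_pt_mat2 off_diag_def mat2_ring mat2_eq_iff algebra_simps)

text \<open>For trace 0 and determinant 1, Cayley-Hamilton gives y^2 = -1; this is the linearised
  equation, in a form that conjugation visibly preserves.\<close>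

definition tangent_quadric :: "cmat \<Rightarrow> cmat set" where
  "tangent_quadric y = {v. y ** v + v ** y = 0}"

lemma tangent_quadric_Ad:
  assumes "k \<in> SL2C"
  shows "Ad k v \<in> tangent_quadric (Ad k y) \<longleftrightarrow> v \<in> tangent_quadric y"
proof -
  have "Ad k y ** Ad k v + Ad k v ** Ad k y = Ad k (y ** v + v ** y)"
    by (simp add: Ad_add Ad_matrix_mult assms)
  moreover have "Ad k A = 0 \<longleftrightarrow> A = 0" for A
    using Ad_scaleR[of _ 0 0] Ad_inverse(2)[OF assms, of A] by auto
  ultimately show ?thesis
    by (simp add: tangent_quadric_def)
qed

lemma tangent_quadric_entries:
  "mat2 p' q' r' t' \<in> tangent_quadric (mat2 p q r (- p)) \<longleftrightarrow>
    2 * p * p' + q * r' + r * q' = 0 \<and> q * (p' + t') = 0 \<and> r * (p' + t') = 0 \<and> - 2 * p * t' + q * r' + r * q' = 0"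
  by (simp add: tangent_quadric_def mat2_ring mat2_eq_iff algebra_simps)

text \<open>The fields of m and i m span all solutions. The off-diagonal entries of v give \<beta>
  and \<gamma> on division by 2 s, and the equations then force the diagonal.\<close>

lemma tangent_quadric_fibre_pt:
  "v \<in> tangent_quadric (fibre_pt w) \<longleftrightarrow> (\<exists>\<beta> \<gamma>. v = commut (off_diag \<beta> \<gamma>) (fibre_pt w))"
proof
  assume v: "v \<in> tangent_quadric (fibre_pt w)"
  define s where "s = complex_of_real (sqrt (1 + w \<bullet> w))"
  have "sqrt (1 + w \<bullet> w) > 0" by (simp add: add_pos_nonneg)
  then have s: "s \<noteq> 0" by (simp add: s_def)
  obtain p q r t where v': "v = mat2 p q r t" by (rule mat2_cases)
  have "2 * (\<i> * s) * p + (- (\<i> * w)) * r + (\<i> * cnj w) * q = 0"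
    "- 2 * (\<i> * s) * t + (- (\<i> * w)) * r + (\<i> * cnj w) * q = 0"
    using v unfolding fibre_pt_mat2 v' s_def[symmetric] tangent_quadric_entries by blast+
  then have "\<i> * (2 * s * p - (w * r - cnj w * q)) = 0" "\<i> * (2 * s * t - (cnj w * q - w * r)) = 0"
    by algebra+
  then have p: "2 * s * p = w * r - cnj w * q" "2 * s * t = cnj w * q - w * r"
    by simp_all
  define \<beta> \<gamma> where "\<beta> = \<i> * q / (2 * s)" and "\<gamma> = - \<i> * r / (2 * s)"
  have "v = commut (off_diag \<beta> \<gamma>) (fibre_pt w)"
    unfolding commut_off_diag_fibre_pt s_def[symmetric] v' \<beta>_def \<gamma>_def using s p
    by (simp add: mat2_eq_iff divide_simps mult.commute) (simp add: algebra_simps)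
  then show "\<exists>\<beta> \<gamma>. v = commut (off_diag \<beta> \<gamma>) (fibre_pt w)" by blast
next
  assume "\<exists>\<beta> \<gamma>. v = commut (off_diag \<beta> \<gamma>) (fibre_pt w)"
  then show "v \<in> tangent_quadric (fibre_pt w)"
    unfolding tangent_quadric_def commut_off_diag_fibre_pt
    by (auto simp: fibre_pt_mat2 mat2_ring mat2_eq_iff algebra_simps)
qed

text \<open>Over x the solutions are commutators, hence traceless, and conjugation carries this to
  every point.\<close>

lemma tangent_quadric_trace:
  assumes "y \<in> orbit_SL2C" "v \<in> tangent_quadric y"
  shows "trace v = 0"
proof -
  obtain k w where k: "k \<in> SU2" "y = Ad k (fibre_pt w)" using assms(1) by (rule orbit_SL2C_cases)
  have "v = Ad k (Ad (matrix_inv k) v)" by (simp add: Ad_inverse SU2_SL2C k(1))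
  moreover from this have "Ad (matrix_inv k) v \<in> tangent_quadric (fibre_pt w)"
    using assms(2) tangent_quadric_Ad[OF SU2_SL2C[OF k(1)]] k(2) by metis
  ultimately obtain \<beta> \<gamma> where "v = Ad k (commut (off_diag \<beta> \<gamma>) (fibre_pt w))"
    unfolding tangent_quadric_fibre_pt by metis
  then show ?thesis
    by (simp add: trace_Ad SU2_SL2C k(1) commut_off_diag_fibre_pt mat2_trace)
qed

lemma bounded_linear_nth2: "bounded_linear (\<lambda>A::cmat. A $ i $ j)"
  using bounded_linear_compose[OF bounded_linear_vec_nth bounded_linear_vec_nth] .

text \<open>Differentiate trace = 0 and det = 1 along the curve. For traceless y and v the condition
  y v + v y = 0 amounts to the single polarised determinant equation.\<close>

lemma tangent_SL2C_subset:
  assumes "y \<in> orbit_SL2C"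
  shows "tangent_space orbit_SL2C y \<subseteq> tangent_quadric y"
proof
  fix v assume "v \<in> tangent_space orbit_SL2C y"
  then obtain \<gamma> \<epsilon> where \<gamma>: "\<epsilon> > 0" "\<And>t::real. \<bar>t\<bar> < \<epsilon> \<Longrightarrow> \<gamma> t \<in> orbit_SL2C" "\<gamma> 0 = y"
    "(\<gamma> has_vector_derivative v) (at 0)"
    unfolding tangent_space_def by blast
  have const: "f' = 0" if f: "(f has_vector_derivative f') (at 0)" "\<And>t. \<bar>t\<bar> < \<epsilon> \<Longrightarrow> f t = c"
    for f :: "real \<Rightarrow> complex" and f' c
  proof -
    have "((\<lambda>_. c) has_vector_derivative f') (at 0)"
      using \<gamma>(1) f(2) by (intro has_vector_derivative_transform_within_open[OF f(1) open_ball[of 0 \<epsilon>]]) auto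
    then show ?thesis
      by (metis has_vector_derivative_const vector_derivative_unique_at)
  qed
  note d = bounded_linear.has_vector_derivative[OF bounded_linear_nth2 \<gamma>(4)]
  have 1: "v $ 1 $ 1 + v $ 2 $ 2 = 0"
    using \<gamma>(2) unfolding orbit_SL2C_iff trace_def sum_2
    by (intro const[OF has_vector_derivative_add[OF d d]]) blast
  have "(\<gamma> 0 $ 1 $ 1 * v $ 2 $ 2 + v $ 1 $ 1 * \<gamma> 0 $ 2 $ 2) -
      (\<gamma> 0 $ 1 $ 2 * v $ 2 $ 1 + v $ 1 $ 2 * \<gamma> 0 $ 2 $ 1) = 0"
    using \<gamma>(2) unfolding orbit_SL2C_iff det_2
    by (intro const[OF has_vector_derivative_diff[OF has_vector_derivative_mult[OF d d] has_vector_derivative_mult[OF d d]]])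
       blast
  then have 2: "(y $ 1 $ 1 * v $ 2 $ 2 + v $ 1 $ 1 * y $ 2 $ 2) -
      (y $ 1 $ 2 * v $ 2 $ 1 + v $ 1 $ 2 * y $ 2 $ 1) = 0" unfolding \<gamma>(3) .
  obtain p q r t where y: "y = mat2 p q r t" by (rule mat2_cases)
  obtain p' q' r' t' where v: "v = mat2 p' q' r' t'" by (rule mat2_cases)
  have t: "t = - p"
    using assms unfolding orbit_SL2C_iff by (simp add: y mat2_trace eq_neg_iff_add_eq_0 add.commute)
  have t': "t' = - p'" using 1 by (simp add: v eq_neg_iff_add_eq_0 add.commute)
  show "v \<in> tangent_quadric y"
    using 2 unfolding y v t t' tangent_quadric_entries by simp algebra
qed

text \<open>The curves are the stereographic lifts of the affine lines \<open>y + t v\<close> to the quadric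
  \<open>det = 1\<close>.\<close>

lemma tangent_quadric_subset:
  assumes "y \<in> orbit_SL2C"
  shows "tangent_quadric y \<subseteq> tangent_space orbit_SL2C y"
proof
  fix v assume v: "v \<in> tangent_quadric y"
  define m where "m = det v"
  \<comment> \<open>With 4 a = t^2 det v, the numerator (1 - a)^2 + t^2 det v of the determinant
    becomes (1 + a)^2.\<close>
  define a where "a = (\<lambda>t::complex. t * t * (m / 4))"
  define \<gamma> where "\<gamma> = (\<lambda>t::real. cscale ((1 - a (of_real t)) / (1 + a (of_real t))) y +
      cscale (of_real t / (1 + a (of_real t))) v)"
  \<comment> \<open>Below this bound t^2 |m| <= |t| |m| < 1, so |a| < 1 and the denominator 1 + a
    does not vanish.\<close>
  define \<epsilon> where "\<epsilon> = 1 / (1 + cmod m)"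
  have \<epsilon>: "\<epsilon> > 0" by (simp add: \<epsilon>_def add_pos_nonneg)
  have "\<gamma> t \<in> orbit_SL2C" if "\<bar>t\<bar> < \<epsilon>" for t
  proof -
    have "\<epsilon> \<le> 1" unfolding \<epsilon>_def by (subst divide_le_eq_1_pos) (simp_all add: add_pos_nonneg)
    then have "\<bar>t\<bar> * \<bar>t\<bar> \<le> \<bar>t\<bar>" using that by (intro mult_left_le) auto
    moreover have "\<bar>t\<bar> * (1 + cmod m) < 1"
      using that by (simp add: \<epsilon>_def field_simps add_pos_nonneg)
    ultimately have "\<bar>t\<bar> * \<bar>t\<bar> * cmod m < 1"
      using mult_right_mono[of "\<bar>t\<bar> * \<bar>t\<bar>" "\<bar>t\<bar>" "cmod m"] by (simp add: algebra_simps)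
    then have "cmod (a (of_real t)) < 1"
      by (simp add: a_def norm_mult norm_divide)
    then have ne: "1 + a (of_real t) \<noteq> 0"
      by (metis add.commute add_eq_0_iff less_irrefl norm_minus_cancel norm_one)
    obtain p q r s where y: "y = mat2 p q r s" by (rule mat2_cases)
    obtain p' q' r' s' where v': "v = mat2 p' q' r' s'" by (rule mat2_cases)
    have s: "s = - p"
      using assms unfolding orbit_SL2C_iff by (simp add: y mat2_trace eq_neg_iff_add_eq_0 add.commute)
    then have dy: "- p * p - q * r = 1"
      using assms unfolding orbit_SL2C_iff by (simp add: y mat2_det)
    have s': "s' = - p'"
      using tangent_quadric_trace[OF assms v] by (simp add: v' mat2_trace eq_neg_iff_add_eq_0 add.commute)
    have pol: "2 * p * p' + q * r' + r * q' = 0"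
      using v unfolding y v' s tangent_quadric_entries by blast
    define A T where "A = a (of_real t)" and "T = complex_of_real t"
    have A: "T * T * (- p' * p' - q' * r') = 4 * A"
      by (simp add: A_def T_def a_def m_def v' s' mat2_det)
    define P Q where "P = (1 - A) / (1 + A)" and "Q = T / (1 + A)"
    have \<gamma>: "\<gamma> t = cscale P y + cscale Q v"
      by (simp add: \<gamma>_def P_def Q_def A_def T_def)
    have tr: "trace (\<gamma> t) = 0"
      by (simp add: \<gamma> y v' s s' mat2_ring)
    have "det (\<gamma> t) = P * P * (- p * p - q * r) - P * Q * (2 * p * p' + q * r' + r * q')
       + Q * Q * (- p' * p' - q' * r')"
      unfolding \<gamma> y v' s s' by (simp add: mat2_cscale mat2_add mat2_det algebra_simps)
    also have "\<dots> = ((1 - A) * (1 - A) + T * T * (- p' * p' - q' * r')) / ((1 + A) * (1 + A))"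
      unfolding pol dy P_def Q_def by (simp add: add_divide_distrib)
    also have "\<dots> = (1 + A) * (1 + A) / ((1 + A) * (1 + A))"
      unfolding A by (simp add: algebra_simps)
    also have "\<dots> = 1"
      using ne unfolding A_def[symmetric] by simp
    finally show ?thesis using tr by (simp add: orbit_SL2C_iff)
  qed
  moreover have "\<gamma> 0 = y"
    by (simp add: \<gamma>_def a_def cmat_eq_iff cscale_def map_matrix_def)
  moreover have "(\<gamma> has_vector_derivative v) (at 0)"
  proof -
    have "((\<lambda>t. (1 - a t) / (1 + a t)) has_field_derivative 0) (at (of_real 0))"
      by (auto simp: a_def intro!: derivative_eq_intros)
    note 1 = has_vector_derivative_real_field[OF this]
    have "((\<lambda>t. t / (1 + a t)) has_field_derivative 1) (at (of_real 0))"
      by (auto simp: a_def intro!: derivative_eq_intros)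
    note 2 = has_vector_derivative_real_field[OF this]
    have L: "bounded_linear (\<lambda>z. cscale z A)" for A
      by (rule linear_conv_bounded_linear[THEN iffD1]) (intro linearI cscale_linear)
    have "(\<gamma> has_vector_derivative (cscale 0 y + cscale 1 v)) (at 0)"
      unfolding \<gamma>_def
      by (intro has_vector_derivative_add bounded_linear.has_vector_derivative[OF L 1] bounded_linear.has_vector_derivative[OF L 2])
    moreover have "cscale 0 y + cscale 1 v = v"
      by (simp add: cscale_def map_matrix_def cmat_eq_iff)
    ultimately show ?thesis by simp
  qed
  ultimately show "v \<in> tangent_space orbit_SL2C y"
    using \<epsilon> by (intro tangent_spaceI[of \<epsilon> \<gamma>]) auto
qed

lemma tangent_SL2C: "y \<in> orbit_SL2C \<Longrightarrow> tangent_space orbit_SL2C y = tangent_quadric y"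
  by (simp add: tangent_SL2C_subset tangent_quadric_subset subset_antisym)

lemma tangent_SL2C_Ad_fibre_pt:
  assumes "k \<in> SU2"
  shows "v \<in> tangent_space orbit_SL2C (Ad k (fibre_pt w)) \<longleftrightarrow>
    (\<exists>\<beta> \<gamma>. v = Ad k (commut (off_diag \<beta> \<gamma>) (fibre_pt w)))"
proof -
  note k = SU2_SL2C[OF assms]
  have "v \<in> tangent_space orbit_SL2C (Ad k (fibre_pt w)) \<longleftrightarrow> Ad (matrix_inv k) v \<in> tangent_quadric (fibre_pt w)"
    using tangent_SL2C[OF Ad_fibre_pt_orbit[OF assms]] tangent_quadric_Ad[OF k, of "Ad (matrix_inv k) v"]
    by (simp add: Ad_inverse[OF k])
  then show ?thesis
    unfolding tangent_quadric_fibre_pt using Ad_inverse[OF k] by metis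
qed

lemma I2_eq_I2_formula:
  assumes "y \<in> orbit_SL2C" "v \<in> tangent_space orbit_SL2C y"
  shows "I2 y v = I2_formula y v"
  using assms I2_Ad_fibre_pt tangent_SL2C_Ad_fibre_pt by (metis orbit_SL2C_cases)

text \<open>Applying the conjugate linear exchange of \<beta> and \<gamma> twice changes the sign of
  both.\<close>

lemma almost_complex_I2: "almost_complex_on orbit_SL2C I2"
proof -
  have "I2 y v \<in> tangent_space orbit_SL2C y \<and> I2 y (I2 y v) = - v"
    if y: "y \<in> orbit_SL2C" "v \<in> tangent_space orbit_SL2C y" for y v
  proof -
    obtain k w where k: "k \<in> SU2" "y = Ad k (fibre_pt w)" using y(1) by (rule orbit_SL2C_cases)
    have J: "I2 y (Ad k (commut (off_diag \<beta> \<gamma>) (fibre_pt w))) =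
        Ad k (commut (off_diag (- \<i> * cnj \<gamma>) (\<i> * cnj \<beta>)) (fibre_pt w))" for \<beta> \<gamma>
      using I2_Ad_fibre_pt[OF k refl] by (simp only: k(2) I2_formula_Ad[OF k(1)] I2_formula_fibre_pt)
    obtain \<beta> \<gamma> where v: "v = Ad k (commut (off_diag \<beta> \<gamma>) (fibre_pt w))"
      using y(2) tangent_SL2C_Ad_fibre_pt[OF k(1)] k(2) by blast
    have "I2 y (I2 y v) = Ad k (commut (off_diag (- \<beta>) (- \<gamma>)) (fibre_pt w))"
      unfolding v J by simp
    also have "\<dots> = - v"
      unfolding v Ad_uminus[symmetric] commut_off_diag_fibre_pt mat2_uminus
      by (intro arg_cong[where f = "Ad k"]) (simp add: mat2_eq_iff algebra_simps)
    finally show ?thesis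
      unfolding k(2) tangent_SL2C_Ad_fibre_pt[OF k(1)] using J[of \<beta> \<gamma>] v k(2) by blast
  qed
  moreover have "I2 y (a *\<^sub>R u + b *\<^sub>R v) = a *\<^sub>R I2 y u + b *\<^sub>R I2 y v"
    if y: "y \<in> orbit_SL2C" "u \<in> tangent_space orbit_SL2C y" "v \<in> tangent_space orbit_SL2C y" for y u v a b
  proof -
    have "y ** (a *\<^sub>R u + b *\<^sub>R v) + (a *\<^sub>R u + b *\<^sub>R v) ** y =
        a *\<^sub>R (y ** u + u ** y) + b *\<^sub>R (y ** v + v ** y)"
      using scaleR_matrix_mult[of 1 y] scaleR_matrix_mult[of _ _ 1 y]
      by (simp add: matrix_add_ldistrib cmat_add_rdistrib scaleR_add_right)
    \<comment> \<open>\<open>I2\<close> agrees with the linear formula on tangent vectors, so the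
      combination has to be tangent first.\<close>
    then have "a *\<^sub>R u + b *\<^sub>R v \<in> tangent_space orbit_SL2C y"
      using y(2,3) unfolding tangent_SL2C[OF y(1)] tangent_quadric_def by simp
    then show ?thesis
      using y by (simp add: I2_eq_I2_formula I2_formula_linear)
  qed
  ultimately show ?thesis
    unfolding almost_complex_on_def by simp
qed

section \<open>Comparison with the compact orbit\<close>

lemma orbit_SU2_subset: "orbit_SU2 \<subseteq> orbit_SL2C"
  unfolding orbit_SU2_def orbit_SL2C_def using SU2_SL2C by blast

text \<open>The compact orbit lies in the real linear space of skew-Hermitian matrices, which
  therefore contains all velocities.\<close>

lemma tangent_SU2_skew:
  assumes "v \<in> tangent_space orbit_SU2 y"
  shows "adj v = - v"
proof -
  obtain \<gamma> \<epsilon> where \<gamma>: "\<epsilon> > 0" "\<And>t::real. \<bar>t\<bar> < \<epsilon> \<Longrightarrow> \<gamma> t \<in> orbit_SU2"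
    "(\<gamma> has_vector_derivative v) (at 0)"
    using assms unfolding tangent_space_def by blast
  have "bounded_linear adj"
    by (rule linear_conv_bounded_linear[THEN iffD1]) (intro linearI adj_add adj_scaleR)
  from bounded_linear.has_vector_derivative[OF this \<gamma>(3)]
  have 1: "((\<lambda>t. adj (\<gamma> t)) has_vector_derivative adj v) (at 0)" .
  have "adj (\<gamma> t) = - \<gamma> t" if t: "t \<in> ball 0 \<epsilon>" for t
  proof -
    obtain k where k: "k \<in> SU2" "\<gamma> t = Ad k x_elem"
      using \<gamma>(2)[of t] t unfolding orbit_SU2_def by auto
    have "adj x_elem = - x_elem" by (simp add: x_elem_def mat2_ring)
    then show ?thesis by (simp add: k Ad_uminus flip: Ad_adj[OF k(1)])
  qed
  then have "((\<lambda>t. - \<gamma> t) has_vector_derivative adj v) (at 0)"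
    using \<gamma>(1) by (intro has_vector_derivative_transform_within_open[OF 1 open_ball[of 0 \<epsilon>]]) simp_all
  then show ?thesis
    by (rule vector_derivative_unique_at[OF _ has_vector_derivative_minus[OF \<gamma>(3)]])
qed

text \<open>Being skew-Hermitian, v comes from an element of m rather than of m + i m, and on m the
  two prescriptions coincide.\<close>

lemma I2_eq_J_CP1:
  assumes "y \<in> orbit_SU2" "v \<in> tangent_space orbit_SU2 y"
  shows "I2 y v = J_CP1 y v"
proof -
  have y: "y \<in> orbit_SL2C" "v \<in> tangent_space orbit_SL2C y"
    using assms orbit_SU2_subset tangent_space_mono by blast+
  obtain k where k: "k \<in> SU2" "y = Ad k x_elem" using assms(1) unfolding orbit_SU2_def by blast
  have x: "x_elem \<in> range fibre_pt" by (metis fibre_pt_0 rangeI)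
  obtain \<beta> \<gamma> where v: "v = Ad k (commut (off_diag \<beta> \<gamma>) x_elem)"
    using y(2) tangent_SL2C_Ad_fibre_pt[OF k(1), of v 0] fibre_pt_0 k(2) by auto
  have "adj (commut (off_diag \<beta> \<gamma>) x_elem) = - commut (off_diag \<beta> \<gamma>) x_elem"
    using tangent_SU2_skew[OF assms(2)] unfolding v Ad_adj[OF k(1), symmetric] Ad_uminus[symmetric]
    by (metis Ad_inverse(2) SU2_SL2C k(1))
  from arg_cong[OF this, of "\<lambda>A. A $ 1 $ 2"] have \<beta>: "\<i> * \<beta> = - (\<i> * cnj \<gamma>)"
    by (simp add: off_diag_def x_elem_def mat2_ring algebra_simps)
  then have "\<i> * (\<beta> + cnj \<gamma>) = 0" unfolding distrib_left \<beta> by simp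
  then have "\<beta> = - cnj \<gamma>" by (simp add: eq_neg_iff_add_eq_0)
  then have c: "off_diag \<beta> \<gamma> \<in> m_alg" by (auto simp: off_diag_def m_alg_def)
  have "mat2 0 (- cnj 0) 0 0 \<in> m_alg" unfolding m_alg_def by blast
  \<comment> \<open>The choice e = 0 and y' = x reduces the prescription of \<open>I2\<close> to
    that of \<open>J_CP1\<close>.\<close>
  then have z: "0 \<in> m_alg" by (simp add: mat2_zero)
  have F: "I2_formula (Ad k' x_elem) (Ad k' (X_field c x_elem)) = Ad k' (X_field (half_ad_x c) x_elem)"
    if "k' \<in> SU2" "c \<in> m_alg" for k' c
    using I2_formula_X_field[OF that(1) x that(2) z]
    by (simp add: X_field_def half_ad_x_def)
  have "J_CP1 y v = I2_formula y v"
    unfolding J_CP1_def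
  proof (rule the_equality)
    show "\<exists>k\<in>SU2. \<exists>c\<in>m_alg. y = Ad k x_elem \<and> v = Ad k (X_field c x_elem) \<and>
        I2_formula y v = Ad k (X_field (half_ad_x c) x_elem)"
      using k(1) c F[OF k(1) c] unfolding k(2) v X_field_def[of "off_diag \<beta> \<gamma>", symmetric] by blast
  next
    fix u
    assume "\<exists>k\<in>SU2. \<exists>c\<in>m_alg. y = Ad k x_elem \<and> v = Ad k (X_field c x_elem) \<and>
        u = Ad k (X_field (half_ad_x c) x_elem)"
    then obtain k c where *: "k \<in> SU2" "c \<in> m_alg" "y = Ad k x_elem"
      "v = Ad k (X_field c x_elem)" "u = Ad k (X_field (half_ad_x c) x_elem)" by blast
    show "u = I2_formula y v" unfolding *(3-5) F[OF *(1,2)] by (rule refl)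
  qed
  then show ?thesis using I2_eq_I2_formula[OF y] by simp
qed

section \<open>Restriction to the fibre\<close>

lemma differential_eqI: "(f has_derivative f') (at x) \<Longrightarrow> differential f x v = f' v"
  by (drule frechet_derivative_at) simp

lemma bounded_linear_fibre_lin: "bounded_linear fibre_lin"
proof (rule linear_conv_bounded_linear[THEN iffD1], rule linearI)
  show "fibre_lin (a + b) = fibre_lin a + fibre_lin b" "fibre_lin (r *\<^sub>R a) = r *\<^sub>R fibre_lin a" for a b r
    by (simp_all add: fibre_lin_def mat2_ring mat2_eq_iff algebra_simps)
qed

lemma Ck_on_sqrt_inner: "Ck_on k (\<lambda>z::complex. sqrt (1 + z \<bullet> z)) S"
  by (intro Ck_on_sqrt Ck_on_add Ck_on_const Ck_on_inner Ck_on_id) (simp add: add_pos_nonneg)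

lemma smooth_on_fibre_pt_cnj: "smooth_on (\<lambda>z. fibre_pt (cnj z)) S"
proof -
  have "Ck_on k (\<lambda>z. sqrt (1 + z \<bullet> z) *\<^sub>R x_elem + fibre_lin (cnj z)) S" for k
    by (intro Ck_on_add Ck_on_scaleR Ck_on_sqrt_inner Ck_on_const Ck_on_linear[OF bounded_linear_fibre_lin]
        Ck_on_linear[OF bounded_linear_cnj] Ck_on_id)
  moreover have "cnj z \<bullet> cnj z = z \<bullet> z" for z by (simp add: inner_complex_def)
  ultimately show ?thesis by (simp add: smooth_on_def fibre_pt_def)
qed

lemma smooth_on_disc_of_fibre: "smooth_on disc_of_fibre S"
  unfolding smooth_on_def disc_of_fibre_def
  by (intro allI Ck_on_scaleR Ck_on_inverse Ck_on_add Ck_on_const Ck_on_sqrt_inner Ck_on_id)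
     (smt (verit) real_sqrt_ge_zero inner_ge_zero)

lemma smooth_on_disc_of_fibre_cnj: "smooth_on (\<lambda>z. disc_of_fibre (cnj z)) S"
proof -
  have "Ck_on k (\<lambda>z. cnj (disc_of_fibre z)) S" for k
    using smooth_on_disc_of_fibre[of S] unfolding smooth_on_def by (intro Ck_on_linear[OF bounded_linear_cnj]) blast
  moreover have "disc_of_fibre (cnj z) = cnj (disc_of_fibre z)" for z by (simp add: disc_of_fibre_def inner_complex_def)
  ultimately show ?thesis by (simp add: smooth_on_def)
qed

lemma Ck_on_inverse_disc: "Ck_on k (\<lambda>Z. inverse (1 - Z \<bullet> Z)) hdisc"
proof -
  have "Ck_on k (\<lambda>Z::complex. inverse (1 + (-1) * (Z \<bullet> Z))) hdisc"
    by (intro Ck_on_inverse Ck_on_add Ck_on_mult Ck_on_const Ck_on_inner Ck_on_id)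
       (simp add: inner_less_1_disc)
  then show ?thesis by simp
qed

lemma Ck_on_fibre_of_disc: "Ck_on k fibre_of_disc hdisc"
  unfolding fibre_of_disc_def
  by (intro Ck_on_scaleR Ck_on_mult Ck_on_const Ck_on_inverse_disc Ck_on_id)

lemma open_hdisc: "open hdisc"
proof -
  have *: "hdisc = ball 0 1" by (auto simp: hdisc_def)
  show ?thesis unfolding * by (rule open_ball)
qed

lemma smooth_on_from_disc: "smooth_on from_disc hdisc"
proof -
  have "Ck_on k from_disc hdisc" for k
  \<comment> \<open>\<open>from_disc\<close> is explicit only on the disc. There it is rational in Z
    and its conjugate, as the square root has been extracted.\<close>
  proof (rule Ck_on_cong[OF _ open_hdisc])
    show "Ck_on k (\<lambda>Z. ((1 + Z \<bullet> Z) * inverse (1 - Z \<bullet> Z)) *\<^sub>R x_elem + fibre_lin (fibre_of_disc Z)) hdisc"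
      by (intro Ck_on_add Ck_on_scaleR Ck_on_mult Ck_on_inner Ck_on_id Ck_on_inverse_disc Ck_on_const
          Ck_on_linear[OF bounded_linear_fibre_lin] Ck_on_fibre_of_disc)
    show "((1 + Z \<bullet> Z) * inverse (1 - Z \<bullet> Z)) *\<^sub>R x_elem + fibre_lin (fibre_of_disc Z) = from_disc Z"
      if "Z \<in> hdisc" for Z
      using that by (simp only: from_disc_eq fibre_pt_def sqrt_fibre_of_disc)
  qed
  then show ?thesis by (simp add: smooth_on_def)
qed

lemma bounded_linear_fibre_coord: "bounded_linear fibre_coord"
  unfolding fibre_coord_def
  by (rule bounded_linear_compose[OF bounded_linear_mult_right bounded_linear_nth2])

lemma differentiable_fibre_coord: "fibre_coord differentiable (at y)"
  using bounded_linear_fibre_coord by (rule bounded_linear_imp_differentiable)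

lemma differentiable_cnj_comp:
  "f differentiable (at x) \<Longrightarrow> (\<lambda>x. cnj (f x)) differentiable (at x)"
  using bounded_linear.has_derivative[OF bounded_linear_cnj] unfolding differentiable_def by blast

lemma from_disc_range: "from_disc ` hdisc = orbit_SU11"
  unfolding orbit_SU11_eq
proof (intro equalityI subsetI)
  fix y assume "y \<in> range fibre_pt"
  then obtain w where "y = fibre_pt w" by blast
  then have "y = from_disc (disc_of_fibre w)" by (simp add: from_disc_eq disc_of_fibre_in fibre_of_disc_disc_of_fibre)
  then show "y \<in> from_disc ` hdisc" using disc_of_fibre_in by blast
qed (auto simp: from_disc_eq)

lemma differentiable_from_disc_left_inverse: "(\<lambda>y. disc_of_fibre (fibre_coord y)) differentiable (at y)"
proof -
  have "disc_of_fibre differentiable (at (fibre_coord y))"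
    using smooth_on_imp_differentiable[OF smooth_on_disc_of_fibre] by blast
  from differentiable_chain_at[OF differentiable_fibre_coord this] show ?thesis
    by (simp add: o_def)
qed

lemma from_disc_left_inverse: "Z \<in> hdisc \<Longrightarrow> disc_of_fibre (fibre_coord (from_disc Z)) = Z"
  by (simp add: from_disc_eq disc_of_fibre_fibre_of_disc)

lemma surface_param_from_disc: "surface_param hdisc from_disc orbit_SU11"
  by (rule surface_paramI[OF open_hdisc smooth_on_from_disc from_disc_range
        differentiable_from_disc_left_inverse from_disc_left_inverse])

lemma differential_fibre_pt_cnj:
  "differential (\<lambda>z. fibre_pt (cnj z)) z w = ((z \<bullet> w) / sqrt (1 + z \<bullet> z)) *\<^sub>R x_elem + fibre_lin (cnj w)"
proof -
  have pos: "1 + z \<bullet> z > 0" by (simp add: add_pos_nonneg)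
  have inner: "((\<lambda>z. 1 + z \<bullet> z) has_derivative (\<lambda>w. 2 * (z \<bullet> w))) (at z)"
    by (auto intro!: derivative_eq_intros simp: inner_commute)
  have "((\<lambda>z. sqrt (1 + z \<bullet> z)) has_derivative (\<lambda>w. (z \<bullet> w) / sqrt (1 + z \<bullet> z))) (at z)"
    using has_derivative_real_sqrt[OF pos inner] by (simp add: field_simps)
  then have "((\<lambda>z. sqrt (1 + z \<bullet> z) *\<^sub>R x_elem + fibre_lin (cnj z)) has_derivative
      (\<lambda>w. ((z \<bullet> w) / sqrt (1 + z \<bullet> z)) *\<^sub>R x_elem + fibre_lin (cnj w))) (at z)"
    by (intro has_derivative_add has_derivative_scaleR_left bounded_linear.has_derivative[OF bounded_linear_fibre_lin]
        has_derivative_cnj has_derivative_ident)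
  moreover have "(\<lambda>z. sqrt (1 + z \<bullet> z) *\<^sub>R x_elem + fibre_lin (cnj z)) = (\<lambda>z. fibre_pt (cnj z))"
    by (simp add: fibre_pt_def inner_complex_def)
  ultimately have "((\<lambda>z. fibre_pt (cnj z)) has_derivative
      (\<lambda>w. ((z \<bullet> w) / sqrt (1 + z \<bullet> z)) *\<^sub>R x_elem + fibre_lin (cnj w))) (at z)"
    by (simp only:)
  then show ?thesis by (rule differential_eqI)
qed

text \<open>The conjugate transpose fixes the Hermitian part, and - 1/2 ad x rotates it by - i. The
  coefficient of x is the derivative of sqrt (1 + |u|^2) in the rotated direction, so the result is
  again tangent to the fibre.\<close>

lemma I2_formula_fibre:
  "I2_formula (fibre_pt u) (r *\<^sub>R x_elem + fibre_lin \<omega>) =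
    ((u \<bullet> (- \<i> * \<omega>)) / sqrt (1 + u \<bullet> u)) *\<^sub>R x_elem + fibre_lin (- \<i> * \<omega>)"
proof -
  define s where "s = sqrt (1 + u \<bullet> u)"
  have s: "s \<noteq> 0" using add_pos_nonneg[of 1 "u \<bullet> u"] by (simp add: s_def)
  let ?y = "mat2 (\<i> * of_real s) (- (\<i> * u)) (\<i> * cnj u) (- (\<i> * of_real s))"
  let ?v = "r *\<^sub>R x_elem + fibre_lin \<omega>"
  have 1: "complex_of_real (u \<bullet> (- \<i> * \<omega>)) = \<i> * (u * cnj \<omega> - \<omega> * cnj u) / 2"
    by (simp add: complex_eq_iff inner_complex_def)
  have 2: "trace (commut (adj ?v) ?y ** x_elem) = 2 * \<i> * (\<omega> * cnj u - u * cnj \<omega>)"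
    by (simp add: fibre_lin_def x_elem_def mat2_ring algebra_simps)
  have T: "trace (commut (adj ?v) ?y ** x_elem) = of_real (- 4 * (u \<bullet> (- \<i> * \<omega>)))"
    unfolding 2 of_real_mult 1 by (simp add: algebra_simps)
  have t: "(- 1 / (4 * s)) *\<^sub>R trace (commut (adj ?v) ?y ** x_elem) = of_real ((u \<bullet> (- \<i> * \<omega>)) / s)"
    unfolding T unfolding scaleR_conv_of_real of_real_mult[symmetric] using s by simp
  have c: "cscale (of_real q) A = q *\<^sub>R A" for q A
    by (simp add: cmat_eq_iff cscale_def map_matrix_def) (simp add: scaleR_conv_of_real)
  have "(- 1 / 2) *\<^sub>R commut x_elem (adj ?v) = fibre_lin (- \<i> * \<omega>)"
    by (simp add: fibre_lin_def x_elem_def mat2_ring mat2_eq_iff algebra_simps) (simp add: scaleR_conv_of_real)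
  then show ?thesis
    unfolding I2_formula_def skew_dir_fibre_pt skew_norm_fibre_pt unfolding fibre_pt_mat2 s_def[symmetric] t c by simp
qed

text \<open>Since cnj (i w) = - i cnj w, conjugating the parameter turns the rotation by - i into
  multiplication by i.\<close>

lemma I2_fibre_pt_cnj:
  "I2 (fibre_pt (cnj z)) (differential (\<lambda>z. fibre_pt (cnj z)) z w) = differential (\<lambda>z. fibre_pt (cnj z)) z (\<i> * w)"
proof -
  let ?D = "differential (\<lambda>z. fibre_pt (cnj z)) z"
  have y: "fibre_pt (cnj z) \<in> orbit_SL2C"
    by (simp add: orbit_SL2C_iff det_fibre_pt trace_fibre_pt)
  have "range ?D \<subseteq> tangent_space orbit_SL2C (fibre_pt (cnj z))"
    by (rule range_differential_subset[OF open_UNIV UNIV_I smooth_on_imp_differentiable[OF smooth_on_fibre_pt_cnj UNIV_I]])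
       (auto simp: orbit_SL2C_iff det_fibre_pt trace_fibre_pt)
  then have "I2 (fibre_pt (cnj z)) (?D w) = I2_formula (fibre_pt (cnj z)) (?D w)"
    using I2_eq_I2_formula[OF y] by blast
  also have "\<dots> = ?D (\<i> * w)"
    unfolding differential_fibre_pt_cnj I2_formula_fibre by (simp add: inner_complex_def)
  finally show ?thesis .
qed

lemma complex_structure_orbit_SU11: "complex_structure_on orbit_SU11 I2"
proof (rule complex_structure_onI[OF open_UNIV smooth_on_fibre_pt_cnj])
  show "range (\<lambda>z. fibre_pt (cnj z)) = orbit_SU11"
    unfolding orbit_SU11_eq
  proof (intro equalityI subsetI)
    fix y assume "y \<in> range fibre_pt"
    then obtain w where "y = fibre_pt (cnj (cnj w))" by auto
    then show "y \<in> range (\<lambda>z. fibre_pt (cnj z))" by blast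
  qed auto
  show "(\<lambda>y. cnj (fibre_coord y)) differentiable (at y)" for y
    by (intro differentiable_cnj_comp differentiable_fibre_coord)
  show "cnj (fibre_coord (fibre_pt (cnj z))) = z" for z
    by simp
qed (rule I2_fibre_pt_cnj)

section \<open>The structure in the disc coordinate\<close>

lemma disc_of_fibre_cnj_range: "range (\<lambda>z. disc_of_fibre (cnj z)) = hdisc"
proof (intro equalityI subsetI)
  fix Z assume "Z \<in> hdisc"
  then have "Z = disc_of_fibre (cnj (cnj (fibre_of_disc Z)))" by (simp add: disc_of_fibre_fibre_of_disc)
  then show "Z \<in> range (\<lambda>z. disc_of_fibre (cnj z))" by blast
qed (auto simp: disc_of_fibre_in)

text \<open>Following this parametrisation of the disc by \<open>from_disc\<close> gives that of the
  fibre, so the chain rule transfers the holomorphy of the latter.\<close>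

lemma I2_disc_disc_of_fibre_cnj:
  "I2_disc (disc_of_fibre (cnj z)) (differential (\<lambda>z. disc_of_fibre (cnj z)) z w) =
    differential (\<lambda>z. disc_of_fibre (cnj z)) z (\<i> * w)"
proof -
  let ?\<psi> = "\<lambda>z. disc_of_fibre (cnj z)"
  let ?D = "differential ?\<psi> z" and ?F = "differential from_disc (?\<psi> z)"
  have from_\<psi>: "from_disc (?\<psi> z) = fibre_pt (cnj z)" for z
    by (simp add: from_disc_eq disc_of_fibre_in fibre_of_disc_disc_of_fibre)
  have "((\<lambda>z. from_disc (?\<psi> z)) has_derivative (\<lambda>w. ?F (?D w))) (at z)"
    by (rule has_derivative_compose[OF
          has_derivative_differential[OF smooth_on_imp_differentiable[OF smooth_on_disc_of_fibre_cnj UNIV_I]]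
          has_derivative_differential[OF smooth_on_imp_differentiable[OF smooth_on_from_disc disc_of_fibre_in]]])
  then have F: "?F (?D w) = differential (\<lambda>z. fibre_pt (cnj z)) z w" for w
    unfolding from_\<psi> by (rule differential_eqI[symmetric])
  \<comment> \<open>Injectivity makes the vector described by \<open>transported\<close>
    unique.\<close>
  have inj: "inj ?F"
    using surface_param_from_disc disc_of_fibre_in unfolding surface_param_def by blast
  show ?thesis
    unfolding I2_disc_def transported_def
  proof (rule the_equality)
    show "?F (?D (\<i> * w)) = I2 (from_disc (?\<psi> z)) (?F (?D w))"
      unfolding F from_\<psi> I2_fibre_pt_cnj by (rule refl)
    then show "u = ?D (\<i> * w)" if "?F u = I2 (from_disc (?\<psi> z)) (?F (?D w))" for u
      using that by (intro injD[OF inj]) simp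
  qed
qed

lemma complex_structure_hdisc: "complex_structure_on hdisc I2_disc"
proof (rule complex_structure_onI[OF open_UNIV smooth_on_disc_of_fibre_cnj disc_of_fibre_cnj_range])
  have "smooth_on fibre_of_disc hdisc" using Ck_on_fibre_of_disc by (simp add: smooth_on_def)
  then show "(\<lambda>Z. cnj (fibre_of_disc Z)) differentiable (at Z)" if "Z \<in> hdisc" for Z
    using that by (intro differentiable_cnj_comp smooth_on_imp_differentiable)
  show "cnj (fibre_of_disc (disc_of_fibre (cnj z))) = z" for z
    by (simp add: fibre_of_disc_disc_of_fibre)
qed (rule I2_disc_disc_of_fibre_cnj)

lemma I2_disc_0: "I2_disc 0 1 = - \<i>"
proof -
  have "((\<lambda>z. inverse (1 + sqrt (1 + cnj z \<bullet> cnj z)) *\<^sub>R cnj z) has_derivative (\<lambda>w. (1 / 2) *\<^sub>R cnj w)) (at 0)"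
    by (auto intro!: derivative_eq_intros)
  then have "differential (\<lambda>z. disc_of_fibre (cnj z)) 0 w = (1 / 2) *\<^sub>R cnj w" for w
    unfolding disc_of_fibre_def by (rule differential_eqI)
  \<comment> \<open>The differential at 0 is half of conjugation, so the direction 2 goes to 1 and 2
    i goes to - i.\<close>
  with I2_disc_disc_of_fibre_cnj[of 0 2] show ?thesis
    by (simp add: disc_of_fibre_def[of 0] scaleR_conv_of_real)
qed

theorem theorem4:
  shows "almost_complex_on orbit_SL2C I2 \<and>
    (\<forall>y\<in>orbit_SU2. \<forall>v\<in>tangent_space orbit_SU2 y. I2 y v = J_CP1 y v) \<and>
    mostow_fibre x_elem = orbit_SU11 \<and>
    bij_betw to_disc orbit_SU11 hdisc \<and> surface_param hdisc from_disc orbit_SU11 \<and>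
    (\<forall>y\<in>orbit_SU11. I2 y ` tangent_space orbit_SU11 y \<subseteq> tangent_space orbit_SU11 y) \<and>
    complex_structure_on orbit_SU11 I2 \<and>
    complex_structure_on hdisc I2_disc \<and>
    (\<exists>Z\<in>hdisc. \<exists>v. I2_disc Z v \<noteq> natural_structure Z v)"
proof (intro conjI)
  show "\<forall>y\<in>orbit_SU2. \<forall>v\<in>tangent_space orbit_SU2 y. I2 y v = J_CP1 y v"
    using I2_eq_J_CP1 by blast
  show "mostow_fibre x_elem = orbit_SU11"
    by (simp add: mostow_fibre_x orbit_SU11_eq)
  show "\<forall>y\<in>orbit_SU11. I2 y ` tangent_space orbit_SU11 y \<subseteq> tangent_space orbit_SU11 y"
    using complex_structure_orbit_SU11 unfolding complex_structure_on_def almost_complex_on_def by blast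
  show "\<exists>Z\<in>hdisc. \<exists>v. I2_disc Z v \<noteq> natural_structure Z v"
  proof (intro bexI exI)
    show "I2_disc 0 1 \<noteq> natural_structure 0 1"
      by (simp add: I2_disc_0 natural_structure_def complex_eq_iff)
    show "0 \<in> hdisc" by (simp add: hdisc_def)
  qed
qed (fact almost_complex_I2 bij_to_disc surface_param_from_disc complex_structure_orbit_SU11
    complex_structure_hdisc)+

end
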